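(* Let $d\ge2$ and $q\ge0$ be integers and let $\epsilon>0$. Consider any (possibly randomized) algorithm that, for any input function $f\in L^2(\mathbb{S}^{d-1})$, makes at most $r$ (possibly adaptive) queries to point values of $f$ and, with probability greater than $1/10$, outputs a function $\tilde f^{(q)}\in\mathcal{H}^{(q)}(\mathbb{S}^{d-1})$ such that $$\|\tilde f^{(q)}-f^{(q)}\|_{\mathbb{S}^{d-1}}^2\le\epsilon\cdot\|f^{(q)}-f\|_{\mathbb{S}^{d-1}}^2 .$$ Then $r\ge\beta_{q,d}$.
   Context: $\mathbb{S}^{d-1}$ is the unit sphere in $\mathbb{R}^d$. $L^2(\mathbb{S}^{d-1})$ is the space of real square-integrable functions on $\mathbb{S}^{d-1}$ with $\langle f,g\rangle_{\mathbb{S}^{d-1}}=\int_{\mathbb{S}^{d-1}}f(w)g(w)\,dw$ (surface measure) and norm $\|f\|_{\mathbb{S}^{d-1}}=\sqrt{\langle f,f\rangle_{\mathbb{S}^{d-1}}}$. A query at $w\in\mathbb{S}^{d-1}$ returns the value $f(w)$. $\mathcal{H}_\ell(\mathbb{S}^{d-1})$ is the space of restrictions to $\mathbb{S}^{d-1}$ of real homogeneous harmonic polynomials of degree $\ell$ in $d$ variables; its dimension is $\alpha_{\ell,d}$. $\mathcal{H}^{(q)}(\mathbb{S}^{d-1})=\bigoplus_{\ell=0}^q\mathcal{H}_\ell(\mathbb{S}^{d-1})$ and $\beta_{q,d}=\sum_{\ell=0}^q\alpha_{\ell,d}=\dim\mathcal{H}^{(q)}(\mathbb{S}^{d-1})$.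 Every $f\in L^2(\mathbb{S}^{d-1})$ has a unique orthogonal expansion $f=\sum_{\ell=0}^\infty f_\ell$ with $f_\ell\in\mathcal{H}_\ell(\mathbb{S}^{d-1})$ (convergence in $L^2$), and $f^{(q)}:=\sum_{\ell=0}^q f_\ell$. *)

theory Defs
  imports "HOL-Probability.Probability" "HOL-Library.Function_Algebras"
begin

text \<open>Pointwise real vector space structure on functions, so that the library's \<open>subspace\<close>,
  \<open>independent\<close> and \<open>dim\<close> apply to spaces of functions.\<close>

instantiation "fun" :: (type, real_vector) real_vector
begin

definition scaleR_fun :: "real \<Rightarrow> ('a \<Rightarrow> 'b) \<Rightarrow> 'a \<Rightarrow> 'b" where
  "scaleR_fun c f = (\<lambda>x. c *\<^sub>R f x)"

instance
  by standard (auto simp: scaleR_fun_def fun_eq_iff scaleR_add_right scaleR_add_left)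

end


section \<open>Square-integrable functions on the unit sphere\<close>

text \<open>The surface measure on the unit sphere of dimension \<open>d - 1\<close>, in the cone form
  \<open>\<sigma>(A) = d * volume {t w | w \<in> A, 0 < t \<le> 1}\<close>; this is the normalisation with
  \<open>\<integral> f dx = \<integral>\<^sub>0\<^sup>\<infinity> t\<^sup>d\<^sup>-\<^sup>1 (\<integral> f(t w) d\<sigma>(w)) dt\<close>.\<close>

definition sphere_measure :: "(real ^ 'd::finite) measure" where
  "sphere_measure = scale_measure (of_nat CARD('d))
     (distr (restrict_space lborel (cball 0 1 - {0})) (restrict_space borel (sphere 0 1))
       (\<lambda>x. x /\<^sub>R norm x))"

text \<open>Since algorithms evaluate their input at points, the elements of \<open>L2_sphere\<close> are functions,
  not classes of almost everywhere equal functions. Their values off the sphere are irrelevant.\<close>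

definition L2_sphere :: "(real ^ 'd::finite \<Rightarrow> real) set" where
  "L2_sphere = {f. f \<in> borel_measurable sphere_measure \<and> integrable sphere_measure (\<lambda>w. (f w)\<^sup>2)}"

definition inner_sphere :: "(real ^ 'd::finite \<Rightarrow> real) \<Rightarrow> (real ^ 'd \<Rightarrow> real) \<Rightarrow> real" where
  "inner_sphere f g = (LINT w|sphere_measure. f w * g w)"

definition norm_sphere :: "(real ^ 'd::finite \<Rightarrow> real) \<Rightarrow> real" where
  "norm_sphere f = sqrt (inner_sphere f f)"


section \<open>Spherical harmonics\<close>

definition homogeneous_poly :: "nat \<Rightarrow> (real ^ 'd::finite \<Rightarrow> real) \<Rightarrow> bool" where
  "homogeneous_poly l p \<longleftrightarrow>
     (\<exists>c :: ('d \<Rightarrow> nat) \<Rightarrow> real. \<forall>x. p x =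
        (\<Sum>m | (\<Sum>i\<in>UNIV. m i) = l. c m * (\<Prod>i\<in>UNIV. (x $ i) ^ m i)))"

definition laplacian :: "(real ^ 'd::finite \<Rightarrow> real) \<Rightarrow> real ^ 'd \<Rightarrow> real" where
  "laplacian p x = (\<Sum>i\<in>UNIV. (deriv ^^ 2) (\<lambda>t. p (x + t *\<^sub>R axis i 1)) 0)"

text \<open>A function on the sphere is represented by its extension by 0 to the whole space; under
  this representation the spaces below are linear subspaces.\<close>

definition restrict_sphere :: "(real ^ 'd::finite \<Rightarrow> real) \<Rightarrow> real ^ 'd \<Rightarrow> real" where
  "restrict_sphere p = (\<lambda>x. if x \<in> sphere 0 1 then p x else 0)"

definition sph_harmonics :: "nat \<Rightarrow> (real ^ 'd::finite \<Rightarrow> real) set" where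
  "sph_harmonics l = {restrict_sphere p |p. homogeneous_poly l p \<and> (\<forall>x. laplacian p x = 0)}"

definition sph_harmonics_upto :: "nat \<Rightarrow> (real ^ 'd::finite \<Rightarrow> real) set" where
  "sph_harmonics_upto q = {(\<Sum>l\<le>q. g l) |g. \<forall>l\<le>q. g l \<in> sph_harmonics l}"

definition alpha :: "'d::finite itself \<Rightarrow> nat \<Rightarrow> nat" where
  "alpha _ l = dim (sph_harmonics l :: (real ^ 'd \<Rightarrow> real) set)"

definition beta :: "'d::finite itself \<Rightarrow> nat \<Rightarrow> nat" where
  "beta d q = (\<Sum>l\<le>q. alpha d l)"

definition harmonic_expansion ::
    "(real ^ 'd::finite \<Rightarrow> real) \<Rightarrow> (nat \<Rightarrow> real ^ 'd \<Rightarrow> real) \<Rightarrow> bool" where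
  "harmonic_expansion f F \<longleftrightarrow>
     (\<forall>l. F l \<in> sph_harmonics l) \<and>
     (\<forall>k l. k \<noteq> l \<longrightarrow> inner_sphere (F k) (F l) = 0) \<and>
     (\<lambda>n. norm_sphere (f - (\<Sum>l\<le>n. F l))) \<longlonglongrightarrow> 0"

definition harmonic_component ::
    "(real ^ 'd::finite \<Rightarrow> real) \<Rightarrow> nat \<Rightarrow> real ^ 'd \<Rightarrow> real" where
  "harmonic_component f = (SOME F. harmonic_expansion f F)"

definition harmonic_truncation ::
    "nat \<Rightarrow> (real ^ 'd::finite \<Rightarrow> real) \<Rightarrow> real ^ 'd \<Rightarrow> real" where
  "harmonic_truncation q f = (\<Sum>l\<le>q. harmonic_component f l)"


section \<open>Randomized adaptive query algorithms\<close>

text \<open>All random choices are encoded in a seed of type \<open>'w\<close>, drawn from a probability space. Given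
  the seed and the list of values received so far, the algorithm decides whether to stop; if not,
  it chooses the next query point, otherwise it produces its output. The earlier query points are
  determined by the seed and the earlier values, so they need not be recorded.\<close>

record ('w, 'd) query_algorithm =
  stops :: "'w \<Rightarrow> real list \<Rightarrow> bool"
  next_query :: "'w \<Rightarrow> real list \<Rightarrow> real ^ 'd"
  result :: "'w \<Rightarrow> real list \<Rightarrow> (real ^ 'd \<Rightarrow> real)"

text \<open>The values received within the first \<open>n\<close> steps. A stopped algorithm makes no more queries.\<close>

primrec answers ::
    "('w, 'd::finite) query_algorithm \<Rightarrow> (real ^ 'd \<Rightarrow> real) \<Rightarrow> 'w \<Rightarrow> nat \<Rightarrow> real list" where
  "answers A f \<omega> 0 = []"
| "answers A f \<omega> (Suc n) =
     (let h = answers A f \<omega> n in if stops A \<omega> h then h else h @ [f (next_query A \<omega> h)])"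

definition at_most_queries ::
    "nat \<Rightarrow> ('w, 'd::finite) query_algorithm \<Rightarrow> (real ^ 'd \<Rightarrow> real) \<Rightarrow> 'w \<Rightarrow> bool" where
  "at_most_queries r A f \<omega> \<longleftrightarrow> stops A \<omega> (answers A f \<omega> r)"

text \<open>The output of a run that makes at most \<open>r\<close> queries.\<close>

definition run ::
    "nat \<Rightarrow> ('w, 'd::finite) query_algorithm \<Rightarrow> (real ^ 'd \<Rightarrow> real) \<Rightarrow> 'w \<Rightarrow> real ^ 'd \<Rightarrow> real" where
  "run r A f \<omega> = result A \<omega> (answers A f \<omega> r)"

text \<open>No measurability in the seed is required here: the only events whose probability is taken
  are the success events for the individual inputs, and a lower bound on \<open>measure M E\<close> by a positive
  number already forces \<open>E\<close> to be measurable, because \<open>measure\<close> is 0 on other sets.\<close>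

definition randomized_query_algorithm ::
    "'w measure \<Rightarrow> ('w, 'd::finite) query_algorithm \<Rightarrow> bool" where
  "randomized_query_algorithm M A \<longleftrightarrow>
     prob_space M \<and> (\<forall>\<omega>\<in>space M. \<forall>h. next_query A \<omega> h \<in> sphere 0 1)"

end

theory Submission
  imports Defs
begin

text \<open>The bound is a counting argument. Suppose \<open>r < \<beta>\<close>, where \<open>\<beta>\<close> is the dimension of \<open>\<H>\<^sup>(\<^sup>q\<^sup>)\<close>, and fix an
  orthonormal basis \<open>e\<close> of that space. The combinations \<open>g c = (\<Sum>i. c i * e i)\<close> with coefficients in
  \<open>{0..<N}\<close> are \<open>N^\<beta>\<close> functions with mutual distances at least 1. The input \<open>f c\<close> is \<open>g c\<close> with its values
  rounded down to multiples of a step \<open>\<eta>\<close> that does not depend on \<open>N\<close>. Both the projection of \<open>f c\<close> to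
  \<open>\<H>\<^sup>(\<^sup>q\<^sup>)\<close> and every admissible output are within a constant times \<open>\<eta>\<close> of \<open>g c\<close> (lemma \<open>output_close\<close>), so for
  small \<open>\<eta>\<close> an admissible output determines \<open>c\<close>. All inputs together take only \<open>O(N)\<close> values. Hence for
  a fixed seed there are only \<open>O(N^r)\<close> transcripts, and as the output is a function of the transcript, at
  most \<open>O(N^r)\<close> of the \<open>N^\<beta>\<close> inputs are treated correctly (lemma \<open>card_distinguished_le\<close>). Averaging over the
  inputs (lemma \<open>average_event_count\<close>) contradicts a success probability of \<open>1/10\<close> once \<open>N\<close> is large.

  The rounding matters: it limits the information in one answer. The functions \<open>g c\<close> themselves could
  all be told apart by one value at a generic point, and replacing the finite family by a
  continuous distribution would require the algorithm to be measurable in the answers.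

  The truncation of a rounded function is understood through its harmonic expansion, whose
  existence requires spherical harmonics to be orthogonal and complete. Orthogonality and the splitting
  of polynomials into harmonic ones both come from one identity for Gaussian integrals (lemma
  \<open>gauss_integral_laplacian\<close>), which is integration by parts together with Euler's identity. It passes
  to the sphere because, for homogeneous polynomials of a fixed degree, the integrals against the
  Gaussian density and over the sphere are proportional (lemma \<open>gauss_integral_homogeneous\<close>). With the Stone-Weierstrass theorem,
  continuous functions, and then rounded ones as bounded pointwise limits, are limits of
  harmonics.\<close>

section \<open>Orthogonality for semidefinite forms\<close>

text \<open>The form is semidefinite, because functions that agree almost everywhere are not identified, and
  it is bilinear only on a subspace, where the integrals that define it exist.\<close>

locale semi_inner_space =
  fixes V :: "'v::real_vector set" and ip :: "'v \<Rightarrow> 'v \<Rightarrow> real"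
  assumes subspace_V: "subspace V"
    and ip_add_left: "x \<in> V \<Longrightarrow> y \<in> V \<Longrightarrow> z \<in> V \<Longrightarrow> ip (x + y) z = ip x z + ip y z"
    and ip_scale_left: "x \<in> V \<Longrightarrow> z \<in> V \<Longrightarrow> ip (c *\<^sub>R x) z = c * ip x z"
    and ip_commute: "ip x y = ip y x"
    and ip_nonneg: "0 \<le> ip x x"
begin

definition seminorm :: "'v \<Rightarrow> real" where
  "seminorm x = sqrt (ip x x)"

lemma ip_add_right: "x \<in> V \<Longrightarrow> y \<in> V \<Longrightarrow> z \<in> V \<Longrightarrow> ip z (x + y) = ip z x + ip z y"
  using ip_add_left ip_commute by metis

lemma ip_scale_right: "x \<in> V \<Longrightarrow> z \<in> V \<Longrightarrow> ip z (c *\<^sub>R x) = c * ip z x"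
  using ip_scale_left ip_commute by metis

lemma ip_zero_left: "z \<in> V \<Longrightarrow> ip 0 z = 0"
  using ip_scale_left[of 0 z 0] subspace_0[OF subspace_V] by simp

lemma ip_zero_right: "z \<in> V \<Longrightarrow> ip z 0 = 0"
  using ip_zero_left ip_commute by metis

lemma ip_diff_left: "x \<in> V \<Longrightarrow> y \<in> V \<Longrightarrow> z \<in> V \<Longrightarrow> ip (x - y) z = ip x z - ip y z"
  using ip_add_left[of x "-1 *\<^sub>R y" z] ip_scale_left[of y z "-1"] subspace_scale[OF subspace_V, of y "-1"]
  by simp

lemma ip_diff_right: "x \<in> V \<Longrightarrow> y \<in> V \<Longrightarrow> z \<in> V \<Longrightarrow> ip z (x - y) = ip z x - ip z y"
  using ip_diff_left ip_commute by metis

lemma ip_sum_left: "(\<And>i. i \<in> I \<Longrightarrow> f i \<in> V) \<Longrightarrow> z \<in> V \<Longrightarrow> ip (\<Sum>i\<in>I. f i) z = (\<Sum>i\<in>I. ip (f i) z)"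
proof (induction I rule: infinite_finite_induct)
  case (insert i I)
  moreover have "(\<Sum>i\<in>I. f i) \<in> V"
    using insert by (intro subspace_sum[OF subspace_V]) auto
  ultimately show ?case by (simp add: ip_add_left)
qed (simp_all add: ip_zero_left)

lemma ip_sum_right: "(\<And>i. i \<in> I \<Longrightarrow> f i \<in> V) \<Longrightarrow> z \<in> V \<Longrightarrow> ip z (\<Sum>i\<in>I. f i) = (\<Sum>i\<in>I. ip z (f i))"
  using ip_sum_left[of I f z] by (simp add: ip_commute[of z])

lemma seminorm_nonneg: "0 \<le> seminorm x"
  by (simp add: seminorm_def ip_nonneg)

lemma seminorm_sq: "(seminorm x)\<^sup>2 = ip x x"
  by (simp add: seminorm_def ip_nonneg)

lemma seminorm_minus_commute: "x \<in> V \<Longrightarrow> y \<in> V \<Longrightarrow> seminorm (x - y) = seminorm (y - x)"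
  unfolding seminorm_def
  by (simp add: ip_diff_left ip_diff_right subspace_diff[OF subspace_V])

text \<open>The value of the form at \<open>x + t *\<^sub>R y\<close> is a nonnegative quadratic function of \<open>t\<close>. If \<open>y\<close> is a null vector,
  this function is affine, hence constant.\<close>

lemma Cauchy_Schwarz_sq:
  assumes "x \<in> V" "y \<in> V"
  shows "(ip x y)\<^sup>2 \<le> ip x x * ip y y"
proof -
  have quad: "0 \<le> ip x x + 2 * t * ip x y + t\<^sup>2 * ip y y" for t
  proof -
    have "t *\<^sub>R y \<in> V"
      using assms subspace_scale[OF subspace_V] by blast
    then have "ip (x + t *\<^sub>R y) (x + t *\<^sub>R y) = ip x x + 2 * t * ip x y + t\<^sup>2 * ip y y"
      using assms by (simp add: ip_add_left ip_add_right ip_scale_left ip_scale_right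
          subspace_add[OF subspace_V] ip_commute[of y x] power2_eq_square algebra_simps)
    then show ?thesis
      using ip_nonneg by metis
  qed
  show ?thesis
  proof (cases "ip y y = 0")
    case False
    then show ?thesis
      using quad[of "- ip x y / ip y y"] ip_nonneg[of y]
      by (simp add: field_simps power2_eq_square)
  next
    case True
    have "ip x y = 0"
    proof (rule ccontr)
      assume "ip x y \<noteq> 0"
      then show False
        using quad[of "- (ip x x + 1) / (2 * ip x y)"] True by (simp add: field_simps)
    qed
    then show ?thesis
      using True by simp
  qed
qed

lemma Cauchy_Schwarz: "x \<in> V \<Longrightarrow> y \<in> V \<Longrightarrow> \<bar>ip x y\<bar> \<le> seminorm x * seminorm y"
  by (rule power2_le_imp_le)
     (simp_all add: power_mult_distrib seminorm_sq Cauchy_Schwarz_sq seminorm_nonneg)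

lemma seminorm_triangle:
  assumes "x \<in> V" "y \<in> V"
  shows "seminorm (x + y) \<le> seminorm x + seminorm y"
proof (rule power2_le_imp_le)
  have "(seminorm (x + y))\<^sup>2 = ip x x + 2 * ip x y + ip y y"
    using assms by (simp add: seminorm_sq ip_add_left ip_add_right subspace_add[OF subspace_V]
        ip_commute[of y x])
  also have "\<dots> \<le> (seminorm x + seminorm y)\<^sup>2"
    using Cauchy_Schwarz[OF assms] by (simp add: power2_sum seminorm_sq)
  finally show "(seminorm (x + y))\<^sup>2 \<le> (seminorm x + seminorm y)\<^sup>2" .
qed (simp add: seminorm_nonneg)

lemma Pythagoras:
  assumes "x \<in> V" "y \<in> V" "ip x y = 0"
  shows "(seminorm (x + y))\<^sup>2 = (seminorm x)\<^sup>2 + (seminorm y)\<^sup>2"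
  using assms by (simp add: seminorm_sq ip_add_left ip_add_right subspace_add[OF subspace_V]
        ip_commute[of y x])

text \<open>For \<open>u\<close> the orthogonal projection of \<open>x\<close> to a subspace and \<open>v\<close> in that subspace.\<close>

lemma seminorm_best_approximation:
  assumes "x \<in> V" "u \<in> V" "v \<in> V" "ip (x - u) (u - v) = 0"
  shows "seminorm (x - u) \<le> seminorm (x - v)" "seminorm (u - v) \<le> seminorm (x - v)"
proof -
  have "x - u \<in> V" "u - v \<in> V"
    using assms subspace_diff[OF subspace_V] by auto
  from Pythagoras[OF this assms(4)]
  have "(seminorm (x - v))\<^sup>2 = (seminorm (x - u))\<^sup>2 + (seminorm (u - v))\<^sup>2"
    by simp
  then have "(seminorm (x - u))\<^sup>2 \<le> (seminorm (x - v))\<^sup>2" "(seminorm (u - v))\<^sup>2 \<le> (seminorm (x - v))\<^sup>2"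
    by simp_all
  from this[THEN power2_le_imp_le]
  show "seminorm (x - u) \<le> seminorm (x - v)" "seminorm (u - v) \<le> seminorm (x - v)"
    using seminorm_nonneg by blast+
qed

lemma orthogonal_to_span:
  assumes "B \<subseteq> V" "x \<in> V" "\<And>b. b \<in> B \<Longrightarrow> ip x b = 0" "v \<in> span B"
  shows "ip x v = 0"
proof -
  have "subspace {v. v \<in> V \<and> ip x v = 0}"
    using subspace_V assms(2)
    by (auto simp: subspace_def ip_add_right ip_scale_right ip_zero_right)
  then have "span B \<subseteq> {v. v \<in> V \<and> ip x v = 0}"
    using assms(1,3) by (intro span_minimal) auto
  then show ?thesis
    using assms(4) by auto
qed

lemma span_subset_V: "B \<subseteq> V \<Longrightarrow> span B \<subseteq> V"
  by (rule span_minimal[OF _ subspace_V])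

text \<open>The Gram-Schmidt step. A null vector \<open>b - w\<close> is orthogonal to everything, so the coefficient 0 that
  division by 0 yields is then the right one.\<close>

lemma orthogonal_projection_exists:
  assumes "finite B" "B \<subseteq> V" "x \<in> V"
  shows "\<exists>u\<in>span B. \<forall>v\<in>span B. ip (x - u) v = 0"
  using assms
proof (induction B arbitrary: x rule: finite_induct)
  case empty
  then show ?case by (simp add: ip_zero_right)
next
  case (insert b B)
  then have B: "B \<subseteq> V" and b: "b \<in> V" and x: "x \<in> V" by auto
  obtain w where w: "w \<in> span B" "\<And>v. v \<in> span B \<Longrightarrow> ip (b - w) v = 0"
    using insert.IH[OF B b] by blast
  obtain u where u: "u \<in> span B" "\<And>v. v \<in> span B \<Longrightarrow> ip (x - u) v = 0"
    using insert.IH[OF B x] by blast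
  have uwV: "u \<in> V" "w \<in> V" "b - w \<in> V" "x - u \<in> V"
    using u w b x span_subset_V[OF B] subspace_diff[OF subspace_V] by blast+
  define c where "c = ip x (b - w) / ip (b - w) (b - w)"
  define y where "y = u + c *\<^sub>R (b - w)"
  have yV: "c *\<^sub>R (b - w) \<in> V" "y \<in> V"
    using uwV subspace_add[OF subspace_V] subspace_scale[OF subspace_V] by (auto simp: y_def)
  have c: "c * ip (b - w) (b - w) = ip x (b - w)"
    using Cauchy_Schwarz_sq[OF x uwV(3)] by (cases "ip (b - w) (b - w) = 0") (auto simp: c_def)
  have sub: "span B \<subseteq> span (insert b B)"
    by (rule span_mono) auto
  have ywd: "ip (x - y) (b - w) = 0"
  proof -
    have "ip u (b - w) = 0"
      using w(2)[OF u(1)] ip_commute by metis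
    then show ?thesis
      using x uwV yV c by (simp add: y_def ip_diff_left ip_add_left ip_scale_left)
  qed
  have ortB: "ip (x - y) v = 0" if "v \<in> span B" for v
  proof -
    have "v \<in> V" using that span_subset_V[OF B] by blast
    then have "ip (x - y) v = ip (x - u) v - c * ip (b - w) v"
      using x uwV yV by (simp add: y_def ip_diff_left ip_add_left ip_scale_left)
    then show ?thesis
      using u(2) w(2) that by simp
  qed
  have xyV: "x - y \<in> V"
    using x yV subspace_diff[OF subspace_V] by blast
  have "ip (x - y) c = 0" if "c \<in> insert b B" for c
  proof (cases "c = b")
    case False
    then show ?thesis
      using that ortB by (simp add: span_base)
  next
    case True
    then show ?thesis
      using ywd ortB[OF w(1)] xyV b uwV by (simp add: ip_diff_right)
  qed
  from orthogonal_to_span[OF insert.prems(1) xyV this]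
  have "ip (x - y) v = 0" if "v \<in> span (insert b B)" for v
    using that by blast
  moreover have "y \<in> span (insert b B)"
    using u(1) w(1) sub unfolding y_def
    by (intro span_add span_scale span_diff) (auto simp: span_base)
  ultimately show ?case by blast
qed

text \<open>Gram-Schmidt, with the family indexed by the given basis so that its size is known.\<close>

lemma orthonormal_family_exists:
  assumes "finite B" "independent B" "B \<subseteq> V"
    and "\<And>v. v \<in> span B \<Longrightarrow> ip v v = 0 \<Longrightarrow> v = 0"
  shows "\<exists>e. (\<forall>b\<in>B. e b \<in> span B) \<and> (\<forall>b\<in>B. \<forall>b'\<in>B. ip (e b) (e b') = (if b = b' then 1 else 0))"
  using assms
proof (induction B rule: finite_induct)
  case (insert b B)
  have sub: "span B \<subseteq> span (insert b B)"
    by (rule span_mono) auto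
  have B: "B \<subseteq> V" "independent B" and b: "b \<in> V" "b \<notin> span B"
    using insert.prems insert.hyps by (auto simp: independent_insert split: if_splits)
  obtain e where e: "\<And>c. c \<in> B \<Longrightarrow> e c \<in> span B"
      "\<And>c c'. c \<in> B \<Longrightarrow> c' \<in> B \<Longrightarrow> ip (e c) (e c') = (if c = c' then 1 else 0)"
    using insert.IH[OF B(2,1)] insert.prems(3) sub by blast
  obtain w where w: "w \<in> span B" "\<And>v. v \<in> span B \<Longrightarrow> ip (b - w) v = 0"
    using orthogonal_projection_exists[OF insert.hyps(1) B(1) b(1)] by blast
  define n where "n = seminorm (b - w)"
  have bwV: "b - w \<in> V"
    using w b span_subset_V[OF B(1)] subspace_diff[OF subspace_V] by blast
  have bw: "b - w \<in> span (insert b B)"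
    using w sub by (intro span_diff) (auto simp: span_base)
  have "b - w \<noteq> 0"
    using b w by auto
  then have "ip (b - w) (b - w) \<noteq> 0"
    using insert.prems(3)[OF bw] by blast
  then have n: "n \<noteq> 0" "ip (b - w) (b - w) = n * n"
    using seminorm_sq[of "b - w"] by (auto simp: n_def power2_eq_square)
  define e' where "e' = e(b := (1 / n) *\<^sub>R (b - w))"
  have "(1 / n) *\<^sub>R (b - w) \<in> V"
    using bwV subspace_scale[OF subspace_V] by blast
  then have 1: "ip (e' b) (e' b) = 1"
    using n bwV by (simp add: e'_def ip_scale_left ip_scale_right)
  have 2: "ip (e' b) (e' c) = 0" if "c \<in> B" for c
    using that insert.hyps(2) e(1)[OF that] w(2) bwV span_subset_V[OF B(1)]
    by (auto simp: e'_def ip_scale_left)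
  have 3: "ip (e' c) (e' c') = (if c = c' then 1 else 0)" if "c \<in> B" "c' \<in> B" for c c'
    using that insert.hyps(2) e(2) by (auto simp: e'_def)
  have 4: "e' c \<in> span (insert b B)" if "c \<in> insert b B" for c
    using that e(1) sub bw by (auto simp: e'_def intro: span_scale)
  have 5: "ip (e' c) (e' c') = (if c = c' then 1 else 0)"
    if "c \<in> insert b B" "c' \<in> insert b B" for c c'
    using that 1 2[of c] 2[of c'] 3[of c c'] insert.hyps(2) ip_commute[of "e' c" "e' c'"] by auto
  show ?case
    using 4 5 by blast
qed simp

end

section \<open>Polynomial functions and their partial derivatives\<close>

lemma sum_fun_apply: "(\<Sum>i\<in>I. f i) x = (\<Sum>i\<in>I. f i x)"
  for f :: "'i \<Rightarrow> 'a \<Rightarrow> 'b::comm_monoid_add"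
  by (induction I rule: infinite_finite_induct) auto

lemma scaleR_fun_apply [simp]: "(c *\<^sub>R f) x = c *\<^sub>R f x"
  by (simp add: scaleR_fun_def)

lemma minus_fun_apply [simp]: "(f - g) x = f x - g x"
  by (simp add: fun_diff_def)

definition monomial :: "('d \<Rightarrow> nat) \<Rightarrow> real ^ 'd::finite \<Rightarrow> real" where
  "monomial m x = (\<Prod>i\<in>UNIV. (x $ i) ^ m i)"

definition polys :: "(real ^ 'd::finite \<Rightarrow> real) set" where
  "polys = span (range monomial)"

text \<open>Unlike the iterated \<open>deriv\<close> in \<open>laplacian\<close>, this is an operator on functions and can be
  composed with itself.\<close>

definition partial :: "'d \<Rightarrow> (real ^ 'd::finite \<Rightarrow> real) \<Rightarrow> real ^ 'd \<Rightarrow> real" where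
  "partial i p x = deriv (\<lambda>t. p (x + t *\<^sub>R axis i 1)) 0"

lemma finite_exponents: "finite {m :: 'd::finite \<Rightarrow> nat. (\<Sum>i\<in>UNIV. m i) = l}"
proof (rule finite_subset)
  show "{m :: 'd \<Rightarrow> nat. (\<Sum>i\<in>UNIV. m i) = l} \<subseteq> (UNIV \<rightarrow>\<^sub>E {..l})"
    by (auto simp: member_le_sum)
qed (simp add: finite_PiE)

text \<open>Homogeneous polynomials of a fixed degree form a finite-dimensional space, and linear
  statements about them need to be checked on monomials only.\<close>

lemma homogeneous_poly_eq_span:
  "Collect (homogeneous_poly l) = span (monomial ` {m :: 'd::finite \<Rightarrow> nat. (\<Sum>i\<in>UNIV. m i) = l})"
    (is "?H = span (monomial ` ?E)")
proof
  show "?H \<subseteq> span (monomial ` ?E)"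
  proof
    fix p :: "real ^ 'd \<Rightarrow> real" assume "p \<in> ?H"
    then obtain c where "\<And>x. p x = (\<Sum>m\<in>?E. c m * monomial m x)"
      by (auto simp: homogeneous_poly_def monomial_def)
    then have "p = (\<Sum>m\<in>?E. c m *\<^sub>R monomial m)"
      by (auto simp: fun_eq_iff sum_fun_apply)
    then show "p \<in> span (monomial ` ?E)"
      by (simp, intro span_sum span_scale span_base imageI)
  qed
  have "subspace ?H"
  proof (rule subspaceI)
    show "0 \<in> ?H"
      by (auto simp: homogeneous_poly_def intro!: exI[of _ "\<lambda>_. 0"])
  next
    fix p q :: "real ^ 'd \<Rightarrow> real" assume "p \<in> ?H" "q \<in> ?H"
    then obtain c c' where "\<And>x. p x = (\<Sum>m\<in>?E. c m * monomial m x)"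
       "\<And>x. q x = (\<Sum>m\<in>?E. c' m * monomial m x)"
      by (auto simp: homogeneous_poly_def monomial_def)
    then show "p + q \<in> ?H"
      by (auto simp: homogeneous_poly_def monomial_def algebra_simps sum.distrib
          intro!: exI[of _ "\<lambda>m. c m + c' m"])
  next
    fix p :: "real ^ 'd \<Rightarrow> real" and a assume "p \<in> ?H"
    then obtain c where "\<And>x. p x = (\<Sum>m\<in>?E. c m * monomial m x)"
      by (auto simp: homogeneous_poly_def monomial_def)
    then show "a *\<^sub>R p \<in> ?H"
      by (auto simp: homogeneous_poly_def monomial_def sum_distrib_left mult.assoc
          intro!: exI[of _ "\<lambda>m. a * c m"])
  qed
  moreover have "homogeneous_poly l (monomial m)" if "m \<in> ?E" for m
    unfolding homogeneous_poly_def
  proof (intro exI allI)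
    fix x
    show "monomial m x = (\<Sum>m' | (\<Sum>i\<in>UNIV. m' i) = l.
        (if m' = m then 1 else 0) * (\<Prod>i\<in>UNIV. x $ i ^ m' i))"
      using that finite_exponents[where 'd = 'd and l = l]
      by (simp add: if_distrib[of "\<lambda>c. c * _"] monomial_def cong: if_cong)
  qed
  ultimately show "span (monomial ` ?E) \<subseteq> ?H"
    by (intro span_minimal) auto
qed

lemma homogeneous_poly_induct [consumes 1, case_names zero step]:
  assumes "homogeneous_poly l p" and "h 0"
    and "\<And>c m q. (\<Sum>i\<in>UNIV. m i) = l \<Longrightarrow> homogeneous_poly l q \<Longrightarrow> h q \<Longrightarrow> h (c *\<^sub>R monomial m + q)"
  shows "h p"
proof -
  have eq: "homogeneous_poly l q \<longleftrightarrow> q \<in> span (monomial ` {m. (\<Sum>i\<in>UNIV. m i) = l})" for q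
    using homogeneous_poly_eq_span by blast
  have "homogeneous_poly l p \<and> h p"
    using assms(1) unfolding eq
  proof (induction rule: span_induct_alt)
    case base
    show "0 \<in> span (monomial ` {m. (\<Sum>i\<in>UNIV. m i) = l}) \<and> h 0"
      using assms(2) by (simp add: span_zero)
  next
    case (step c x y)
    then show "c *\<^sub>R x + y \<in> span (monomial ` {m. (\<Sum>i\<in>UNIV. m i) = l}) \<and> h (c *\<^sub>R x + y)"
      using assms(3)[unfolded eq] by (auto intro: span_add span_scale span_base simp del: plus_fun_apply)
  qed
  then show ?thesis by simp
qed

lemma subspace_homogeneous_poly: "subspace (Collect (homogeneous_poly l))"
  by (simp add: homogeneous_poly_eq_span subspace_span)

lemmas homogeneous_poly_zero = subspace_0[OF subspace_homogeneous_poly, unfolded mem_Collect_eq]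
lemmas homogeneous_poly_add = subspace_add[OF subspace_homogeneous_poly, unfolded mem_Collect_eq]
lemmas homogeneous_poly_scale = subspace_scale[OF subspace_homogeneous_poly, unfolded mem_Collect_eq]
lemmas homogeneous_poly_diff = subspace_diff[OF subspace_homogeneous_poly, unfolded mem_Collect_eq]
lemmas homogeneous_poly_sum = subspace_sum[OF subspace_homogeneous_poly, unfolded mem_Collect_eq]

lemma homogeneous_poly_monomial: "homogeneous_poly (\<Sum>i\<in>UNIV. m i) (monomial m)"
proof -
  have "monomial m \<in> Collect (homogeneous_poly (\<Sum>i\<in>UNIV. m i))"
    unfolding homogeneous_poly_eq_span by (rule span_base) auto
  then show ?thesis by simp
qed

lemma subspace_polys: "subspace polys"
  by (simp add: polys_def subspace_span)

lemmas polys_zero = subspace_0[OF subspace_polys]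
lemmas polys_add = subspace_add[OF subspace_polys]
lemmas polys_scale = subspace_scale[OF subspace_polys]
lemmas polys_diff = subspace_diff[OF subspace_polys]
lemmas polys_sum = subspace_sum[OF subspace_polys]

lemma monomial_in_polys: "monomial m \<in> polys"
  by (simp add: polys_def span_base)

lemma polys_induct [consumes 1, case_names zero step]:
  assumes "p \<in> polys" and "h 0"
    and "\<And>c m q. q \<in> polys \<Longrightarrow> h q \<Longrightarrow> h (c *\<^sub>R monomial m + q)"
  shows "h p"
proof -
  have "p \<in> polys \<and> h p"
    using assms(1) unfolding polys_def
  proof (induction rule: span_induct_alt)
    case base
    show "0 \<in> span (range monomial) \<and> h 0"
      using assms(2) by (simp add: span_zero)
  next
    case (step c x y)
    then show "c *\<^sub>R x + y \<in> span (range monomial) \<and> h (c *\<^sub>R x + y)"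
      using assms(3)[unfolded polys_def] by (auto intro: span_add span_scale span_base)
  qed
  then show ?thesis by simp
qed

lemma homogeneous_imp_polys: "homogeneous_poly l p \<Longrightarrow> p \<in> polys"
  by (rule homogeneous_poly_induct[of l p "\<lambda>p. p \<in> polys"])
     (auto intro: polys_zero polys_add polys_scale monomial_in_polys)

lemma scaleR_times_fun:
  fixes p q :: "'a \<Rightarrow> real"
  shows "(c *\<^sub>R p) * q = c *\<^sub>R (p * q)" and "p * (c *\<^sub>R q) = c *\<^sub>R (p * q)"
  by (simp_all add: fun_eq_iff)

lemma span_times:
  fixes p q :: "'a \<Rightarrow> real"
  assumes "p \<in> span A" "q \<in> span B" and AB: "\<And>a b. a \<in> A \<Longrightarrow> b \<in> B \<Longrightarrow> a * b \<in> span C"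
  shows "p * q \<in> span C"
proof -
  have "subspace {q. a * q \<in> span C}" for a :: "'a \<Rightarrow> real"
    by (rule subspaceI) (simp_all add: scaleR_times_fun distrib_left span_zero span_add span_scale)
  then have "span B \<subseteq> {q. a * q \<in> span C}" if "a \<in> A" for a
    using AB[OF that] by (intro span_minimal) auto
  then have 1: "a * q \<in> span C" if "a \<in> A" for a
    using assms(2) that by blast
  have "subspace {p. p * q \<in> span C}"
    by (rule subspaceI) (simp_all add: scaleR_times_fun distrib_right span_zero span_add span_scale)
  then have "span A \<subseteq> {p. p * q \<in> span C}"
    using 1 by (intro span_minimal) auto
  then show ?thesis
    using assms(1) by blast
qed

lemma monomial_times: "monomial m * monomial m' = monomial (\<lambda>i. m i + m' i)"
  by (auto simp: fun_eq_iff monomial_def power_add prod.distrib)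

lemma polys_times: "p \<in> polys \<Longrightarrow> q \<in> polys \<Longrightarrow> p * q \<in> polys"
  unfolding polys_def by (erule (1) span_times) (auto simp: monomial_times intro: span_base)

lemma homogeneous_poly_times:
  assumes "homogeneous_poly k p" "homogeneous_poly l q"
  shows "homogeneous_poly (k + l) (p * q)"
proof -
  have "p * q \<in> Collect (homogeneous_poly (k + l))"
    unfolding homogeneous_poly_eq_span
    using assms[folded mem_Collect_eq[of _ "homogeneous_poly _"], unfolded homogeneous_poly_eq_span]
    by (rule span_times) (auto simp: monomial_times sum.distrib intro!: span_base)
  then show ?thesis by simp
qed

lemma monomial_axis: "monomial (\<lambda>j. if j = i then 1 else 0) = (\<lambda>x. x $ i)"
  by (auto simp: fun_eq_iff monomial_def if_distrib[of "\<lambda>n. _ ^ n"] cong: if_cong)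

lemma homogeneous_poly_coordinate: "homogeneous_poly 1 (\<lambda>x. x $ i)"
  using homogeneous_poly_monomial[of "\<lambda>j. if j = i then 1 else 0"] by (simp add: monomial_axis)

lemma coordinate_in_polys: "(\<lambda>x. x $ i) \<in> polys"
  using homogeneous_poly_coordinate by (rule homogeneous_imp_polys)

lemma homogeneous_poly_norm_square: "homogeneous_poly 2 (\<lambda>x :: real ^ 'd::finite. (norm x)\<^sup>2)"
proof -
  have "(\<lambda>x. (norm x)\<^sup>2) = (\<Sum>i\<in>UNIV. (\<lambda>x. x $ i) * (\<lambda>x::real^'d. x $ i))"
    by (simp add: fun_eq_iff sum_fun_apply norm_vec_def L2_set_def power2_eq_square sum_nonneg)
  moreover have "homogeneous_poly 2 ((\<lambda>x. x $ i) * (\<lambda>x::real^'d. x $ i))" for i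
    using homogeneous_poly_times[OF homogeneous_poly_coordinate homogeneous_poly_coordinate]
    by (simp add: numeral_2_eq_2)
  ultimately show ?thesis
    by (simp only: homogeneous_poly_sum)
qed

lemma continuous_on_poly: "p \<in> polys \<Longrightarrow> continuous_on S p"
proof (induction rule: polys_induct)
  case (step c m q)
  have "continuous_on S (\<lambda>x. c * monomial m x + q x)"
    unfolding monomial_def using step by (intro continuous_intros) auto
  then show ?case
    by (simp add: plus_fun_def)
qed (simp add: zero_fun_def)

lemma homogeneous_poly_scale_arg: "homogeneous_poly l p \<Longrightarrow> p (c *\<^sub>R x) = c ^ l * p x"
proof (induction rule: homogeneous_poly_induct)
  case (step a m q)
  then show ?case
    by (auto simp: monomial_def power_mult_distrib prod.distrib algebra_simps
        simp flip: power_sum)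
qed simp

lemma monomial_has_derivative:
  "((\<lambda>t. monomial m (x + t *\<^sub>R axis i 1)) has_real_derivative
      real (m i) * monomial (m(i := m i - 1)) (x + t *\<^sub>R axis i 1)) (at t)"
proof -
  have split: "monomial k (x + t *\<^sub>R axis i 1) = (x $ i + t) ^ k i * (\<Prod>j\<in>UNIV - {i}. (x $ j) ^ k j)" for k t
  proof -
    have "monomial k (x + t *\<^sub>R axis i 1) = (x $ i + t) ^ k i *
        (\<Prod>j\<in>UNIV - {i}. ((x + t *\<^sub>R axis i 1) $ j) ^ k j)"
      unfolding monomial_def by (subst prod.remove[of _ i]) (auto simp: axis_def)
    also have "(\<Prod>j\<in>UNIV - {i}. ((x + t *\<^sub>R axis i 1) $ j) ^ k j) = (\<Prod>j\<in>UNIV - {i}. (x $ j) ^ k j)"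
      by (intro prod.cong) (auto simp: axis_def)
    finally show ?thesis .
  qed
  show ?thesis
    unfolding split by (auto intro!: derivative_eq_intros)
qed

lemma partial_eqI:
  "((\<lambda>t. p (x + t *\<^sub>R axis i 1)) has_real_derivative D) (at 0) \<Longrightarrow> partial i p x = D"
  unfolding partial_def by (rule DERIV_imp_deriv)

lemma partial_monomial: "partial i (monomial m) = real (m i) *\<^sub>R monomial (m(i := m i - 1))"
  using monomial_has_derivative[of m _ i 0] by (auto simp: fun_eq_iff intro!: partial_eqI)

text \<open>The operator \<open>partial\<close> is linear only on differentiable functions, so the induction first produces
  some derivative; it is recognised as \<open>partial i p\<close> at parameter 0.\<close>

lemma poly_has_derivative:
  assumes "p \<in> polys"
  shows "((\<lambda>t. p (x + t *\<^sub>R axis i 1)) has_real_derivative partial i p (x + t *\<^sub>R axis i 1)) (at t)"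
proof -
  have "\<exists>p'. \<forall>x t. ((\<lambda>t. p (x + t *\<^sub>R axis i 1)) has_real_derivative p' (x + t *\<^sub>R axis i 1)) (at t)"
    using assms
  proof (induction rule: polys_induct)
    case zero
    then show ?case by (intro exI[of _ 0]) auto
  next
    case (step c m q)
    then obtain q' where q': "\<And>x t. ((\<lambda>t. q (x + t *\<^sub>R axis i 1)) has_real_derivative q' (x + t *\<^sub>R axis i 1)) (at t)"
      by blast
    have "((\<lambda>t. (c *\<^sub>R monomial m + q) (x + t *\<^sub>R axis i 1)) has_real_derivative
        (c *\<^sub>R partial i (monomial m) + q') (x + t *\<^sub>R axis i 1)) (at t)" for x t
      by (auto simp: partial_monomial intro!: derivative_eq_intros monomial_has_derivative q')
    then show ?case by blast
  qed
  then obtain p' where p': "\<And>x t. ((\<lambda>t. p (x + t *\<^sub>R axis i 1)) has_real_derivative p' (x + t *\<^sub>R axis i 1)) (at t)"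
    by blast
  have "partial i p = p'"
    using p'[of _ 0] by (auto simp: fun_eq_iff intro!: partial_eqI)
  then show ?thesis using p' by simp
qed

lemmas poly_has_derivative_0 = poly_has_derivative[where t = 0, simplified]

lemma partial_zero: "partial i 0 = 0"
  by (auto simp: fun_eq_iff intro!: partial_eqI)

lemma partial_add: "p \<in> polys \<Longrightarrow> q \<in> polys \<Longrightarrow> partial i (p + q) = partial i p + partial i q"
  by (auto simp: fun_eq_iff intro!: partial_eqI derivative_eq_intros poly_has_derivative_0)

lemma partial_scale: "p \<in> polys \<Longrightarrow> partial i (c *\<^sub>R p) = c *\<^sub>R partial i p"
  by (auto simp: fun_eq_iff intro!: partial_eqI derivative_eq_intros poly_has_derivative_0)

lemma partial_times:
  "p \<in> polys \<Longrightarrow> q \<in> polys \<Longrightarrow> partial i (p * q) = partial i p * q + p * partial i q"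
  by (auto simp: fun_eq_iff intro!: partial_eqI derivative_eq_intros poly_has_derivative_0)

lemma partial_in_polys: "p \<in> polys \<Longrightarrow> partial i p \<in> polys"
proof (induction rule: polys_induct)
  case (step c m q)
  then show "partial i (c *\<^sub>R monomial m + q) \<in> polys"
    by (auto simp: partial_add partial_scale partial_monomial polys_scale monomial_in_polys
        intro!: polys_add polys_scale)
next
  case zero
  show "partial i 0 \<in> polys" by (simp only: partial_zero polys_zero)
qed

lemma homogeneous_poly_partial:
  "homogeneous_poly (Suc l) p \<Longrightarrow> homogeneous_poly l (partial i p)"
proof (induction rule: homogeneous_poly_induct)
  case (step c m q)
  have "homogeneous_poly l (real (m i) *\<^sub>R monomial (m(i := m i - 1)))"
  proof (cases "m i")
    case 0
    then show ?thesis
      using homogeneous_poly_zero by simp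
  next
    case (Suc k)
    have "(\<Sum>j\<in>UNIV. (m(i := m i - 1)) j) = (m i - 1) + (\<Sum>j\<in>UNIV - {i}. m j)"
      by (subst sum.remove[of _ i]) auto
    also have "\<dots> = l"
      using step(1) Suc by (subst (asm) sum.remove[of _ i]) auto
    finally show ?thesis
      using homogeneous_poly_monomial[of "m(i := m i - 1)"] homogeneous_poly_scale by metis
  qed
  then have "homogeneous_poly l (c *\<^sub>R (real (m i) *\<^sub>R monomial (m(i := m i - 1))) + partial i q)"
    using step by (intro homogeneous_poly_add homogeneous_poly_scale[where c = c])
  then show "homogeneous_poly l (partial i (c *\<^sub>R monomial m + q))"
    using step(2)
    by (simp add: partial_add partial_scale partial_monomial polys_scale monomial_in_polys
        homogeneous_imp_polys del: scaleR_scaleR)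
next
  case zero
  show "homogeneous_poly l (partial i 0)" by (simp only: partial_zero homogeneous_poly_zero)
qed

lemma partial_homogeneous_poly_0: "homogeneous_poly 0 p \<Longrightarrow> partial i p = 0"
proof (induction rule: homogeneous_poly_induct)
  case (step c m q)
  have "partial i q = 0"
    using step(3) by (simp add: fun_eq_iff)
  then show "partial i (c *\<^sub>R monomial m + q) = 0"
    using step(1,2) by (simp add: partial_add partial_scale partial_monomial polys_scale
        monomial_in_polys homogeneous_imp_polys)
next
  case zero
  show "partial i 0 = 0" by (rule partial_zero)
qed

lemma laplacian_eq:
  assumes "p \<in> polys"
  shows "laplacian p = (\<Sum>i\<in>UNIV. partial i (partial i p))"
proof
  fix x
  have "(deriv ^^ 2) (\<lambda>t. p (x + t *\<^sub>R axis i 1)) 0 = partial i (partial i p) x" for i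
  proof -
    have "deriv (\<lambda>t. p (x + t *\<^sub>R axis i 1)) = (\<lambda>t. partial i p (x + t *\<^sub>R axis i 1))"
      using poly_has_derivative[OF assms] by (intro ext DERIV_imp_deriv)
    then show ?thesis
      by (simp add: numeral_2_eq_2 partial_def)
  qed
  then show "laplacian p x = (\<Sum>i\<in>UNIV. partial i (partial i p)) x"
    by (simp add: laplacian_def sum_fun_apply)
qed

lemma euler_homogeneous_poly:
  "homogeneous_poly l p \<Longrightarrow> (\<Sum>i\<in>UNIV. (\<lambda>x. x $ i) * partial i p) = real l *\<^sub>R p"
proof (induction rule: homogeneous_poly_induct)
  case (step c m q)
  have "real (m i) * (x $ i * monomial (m(i := m i - 1)) x) = real (m i) * monomial m x" for i x
  proof (cases "m i")
    case (Suc k)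
    have "x $ i * monomial (m(i := m i - 1)) x = monomial m x"
      unfolding monomial_def by (subst (1 2) prod.remove[of _ i]) (auto simp: Suc)
    then show ?thesis by simp
  qed simp
  then have *: "(\<Sum>i\<in>UNIV. (\<lambda>x. x $ i) * partial i (monomial m)) = real l *\<^sub>R monomial m"
    unfolding step(1)[symmetric]
    by (simp only: fun_eq_iff sum_fun_apply partial_monomial sum_distrib_right of_nat_sum
        times_fun_apply scaleR_fun_apply real_scaleR_def mult.left_commute[of "_ $ _"]) simp
  have "(\<Sum>i\<in>UNIV. (\<lambda>x. x $ i) * partial i (c *\<^sub>R monomial m + q))
     = c *\<^sub>R (\<Sum>i\<in>UNIV. (\<lambda>x. x $ i) * partial i (monomial m)) + (\<Sum>i\<in>UNIV. (\<lambda>x. x $ i) * partial i q)"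
    using step
    by (simp add: partial_add partial_scale polys_scale monomial_in_polys homogeneous_imp_polys
        fun_eq_iff sum_fun_apply sum.distrib sum_distrib_left algebra_simps)
  moreover have "(\<Sum>i\<in>UNIV. (\<lambda>x. x $ i) * partial i q) = real l *\<^sub>R q"
    using step(3) by (simp add: fun_eq_iff sum_fun_apply)
  ultimately show "(\<Sum>i\<in>UNIV. (\<lambda>x. x $ i) * partial i (c *\<^sub>R monomial m + q)) = real l *\<^sub>R (c *\<^sub>R monomial m + q)"
    unfolding * by (simp add: fun_eq_iff algebra_simps)
next
  case zero
  have "(\<Sum>i\<in>UNIV. (\<lambda>x. x $ i) * partial i 0) = real l *\<^sub>R 0"
    by (simp only: partial_zero) (simp add: fun_eq_iff sum_fun_apply)
  then show "(\<Sum>i\<in>UNIV. (\<lambda>x. x $ i) * partial i 0) = real l *\<^sub>R 0" .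
qed

lemma polys_eq_sum_homogeneous:
  "p \<in> polys \<Longrightarrow> \<exists>n g. (\<forall>l. homogeneous_poly l (g l)) \<and> p = (\<Sum>l\<le>n. g l)"
proof (induction rule: polys_induct)
  case zero
  show "\<exists>n g. (\<forall>l. homogeneous_poly l (g l)) \<and> 0 = (\<Sum>l\<le>n. g l)"
    using homogeneous_poly_zero by (intro exI[of _ "0::nat"] exI[of _ "\<lambda>_. 0"]) (auto simp del: zero_fun_apply)
next
  case (step c m q)
  then obtain n g where g: "\<And>l. homogeneous_poly l (g l)" "q = (\<Sum>l\<le>n. g l)"
    by blast
  define k where "k = (\<Sum>i\<in>UNIV. m i)"
  define g' where "g' l = (if l \<le> n then g l else 0) + (if l = k then c *\<^sub>R monomial m else 0)" for l
  have "homogeneous_poly l (g' l)" for l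
    using g homogeneous_poly_monomial[of m]
    by (auto simp: g'_def k_def intro!: homogeneous_poly_add homogeneous_poly_zero homogeneous_poly_scale)
  moreover have "(\<Sum>l\<le>n + k. g' l) = c *\<^sub>R monomial m + q"
  proof -
    have "(\<Sum>l\<le>n + k. if l \<le> n then g l else 0) = (\<Sum>l\<le>n. g l)"
      by (rule sum.mono_neutral_cong_right) auto
    then show ?thesis
      by (simp add: g'_def sum.distrib g)
  qed
  ultimately show ?case by metis
qed

lemma real_polynomial_function_imp_polys: "real_polynomial_function p \<Longrightarrow> p \<in> polys"
  for p :: "real ^ 'd::finite \<Rightarrow> real"
proof (induction rule: real_polynomial_function.induct)
  case (linear f)
  then interpret bounded_linear f .
  have "f = (\<Sum>i\<in>UNIV. f (axis i 1) *\<^sub>R (\<lambda>x. x $ i))"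
  proof
    fix x
    have "f x = f (\<Sum>i\<in>UNIV. (x $ i) *\<^sub>R axis i 1)"
      using basis_expansion[of x] by (simp add: scalar_mult_eq_scaleR)
    then show "f x = (\<Sum>i\<in>UNIV. f (axis i 1) *\<^sub>R (\<lambda>x. x $ i)) x"
      by (simp add: sum_fun_apply sum scaleR mult.commute)
  qed
  moreover have "(\<Sum>i\<in>UNIV. f (axis i 1) *\<^sub>R (\<lambda>x::real^'d. x $ i)) \<in> polys"
    by (intro polys_sum polys_scale coordinate_in_polys)
  ultimately show ?case by simp
next
  case (const c)
  have "(\<lambda>x. c) = c *\<^sub>R monomial (\<lambda>_. 0)"
    by (simp add: fun_eq_iff monomial_def)
  then show "(\<lambda>x. c) \<in> polys"
    by (metis polys_scale monomial_in_polys)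
next
  case (add f g)
  then show ?case using polys_add[of f g] by (simp add: plus_fun_def)
next
  case (mult f g)
  then show ?case using polys_times[of f g] by (simp add: times_fun_def)
qed

section \<open>Gaussian integrals of polynomials\<close>

text \<open>Fubini for products of functions of one coordinate. Lebesgue measure is a product over the standard
  basis, whose elements correspond to the coordinates.\<close>

lemma lborel_product_integral:
  fixes f :: "'d::finite \<Rightarrow> real \<Rightarrow> real"
  assumes "\<And>i. integrable lborel (f i)"
  shows "integrable lborel (\<lambda>x :: real ^ 'd. \<Prod>i\<in>UNIV. f i (x $ i))"
    and "(LINT x|lborel. (\<Prod>i\<in>UNIV. f i ((x :: real ^ 'd) $ i))) = (\<Prod>i\<in>UNIV. LINT t|lborel. f i t)"
proof -
  interpret product_sigma_finite "\<lambda>_ :: real ^ 'd. lborel :: real measure" ..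
  have meas [measurable]: "f i \<in> borel_measurable borel" for i
    using borel_measurable_integrable[OF assms] by simp
  define F where "F = (\<lambda>b :: real ^ 'd. f (inv (\<lambda>i. axis i 1) b))"
  have inj: "inj (\<lambda>i :: 'd. axis i (1 :: real))"
    by (auto simp: inj_def axis_eq_axis)
  have Basis: "(Basis :: (real ^ 'd) set) = range (\<lambda>i. axis i 1)"
    by (auto simp: Basis_vec_def)
  have F: "F (axis i 1) = f i" for i
    by (simp add: F_def inv_f_f[OF inj])
  have prod: "(\<Prod>i\<in>UNIV. f i ((\<Sum>b\<in>Basis. g b *\<^sub>R b) $ i)) = (\<Prod>b\<in>Basis. F b (g b))" for g :: "real ^ 'd \<Rightarrow> real"
  proof -
    have "(\<Sum>b\<in>Basis. g b *\<^sub>R b) $ i = g (axis i 1)" for i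
    proof -
      have "(\<Sum>b\<in>Basis. g b *\<^sub>R b) $ i = (\<Sum>b\<in>Basis. g b *\<^sub>R b) \<bullet> axis i 1"
        by (simp add: inner_axis)
      also have "\<dots> = g (axis i 1)"
        by (rule inner_sum_left_Basis) (simp add: Basis)
      finally show ?thesis .
    qed
    then show ?thesis
      by (simp add: Basis prod.reindex[OF inj] F)
  qed
  have F_int: "integrable lborel (F b)" for b
    unfolding F_def by (rule assms)
  have *: "(\<lambda>x :: real ^ 'd. \<Prod>i\<in>UNIV. f i (x $ i)) \<in> borel_measurable borel"
    by measurable
  show "integrable lborel (\<lambda>x :: real ^ 'd. \<Prod>i\<in>UNIV. f i (x $ i))"
    by (subst lborel_eq, subst integrable_distr_eq)
       (simp_all add: prod * product_integrable_prod F_int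
        del: sum_component vector_scaleR_component)
  have "(LINT x|lborel. (\<Prod>i\<in>UNIV. f i ((x :: real ^ 'd) $ i))) = (\<Prod>b\<in>Basis. LINT t|lborel. F b t)"
    by (subst lborel_eq, subst integral_distr)
       (simp_all add: prod * product_integral_prod F_int
        del: sum_component vector_scaleR_component)
  then show "(LINT x|lborel. (\<Prod>i\<in>UNIV. f i ((x :: real ^ 'd) $ i))) = (\<Prod>i\<in>UNIV. LINT t|lborel. f i t)"
    by (simp add: Basis prod.reindex[OF inj] F)
qed

definition gauss_density :: "real ^ 'd::finite \<Rightarrow> real" where
  "gauss_density x = (\<Prod>i\<in>UNIV. std_normal_density (x $ i))"

definition gauss_integral :: "(real ^ 'd::finite \<Rightarrow> real) \<Rightarrow> real" where
  "gauss_integral p = (LINT x|lborel. gauss_density x * p x)"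

definition gauss_moment :: "nat \<Rightarrow> real" where
  "gauss_moment k = (LINT t|lborel. std_normal_density t * t ^ k)"

text \<open>The one-dimensional integration by parts, read off the known moments. For \<open>k = 0\<close> the factor
  \<open>k\<close> makes the right-hand side 0, the first moment.\<close>

lemma gauss_moment_Suc: "gauss_moment (Suc k) = real k * gauss_moment (k - 1)"
proof (cases "even k")
  case True
  then obtain j where j: "k = 2 * j" by blast
  have "gauss_moment (k - 1) = 0" if "k > 0"
  proof -
    have "k - 1 = 2 * (j - 1) + 1" using that j by simp
    then show ?thesis
      using integral_std_normal_moment_odd[of "j - 1"] by (simp only: gauss_moment_def)
  qed
  then show ?thesis
    using integral_std_normal_moment_odd[of j] j by (cases "k = 0") (simp_all add: gauss_moment_def)
next
  case False
  then obtain j where j: "k = 2 * j + 1"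
    by (metis oddE)
  have "gauss_moment (Suc k) = fact (2 * Suc j) / (2 ^ Suc j * fact (Suc j))"
    using integral_std_normal_moment_even[of "Suc j"] j by (simp add: gauss_moment_def)
  also have "\<dots> = real k * (fact (2 * j) / (2 ^ j * fact j))"
  proof -
    have "fact (2 * Suc j) = (2 * (real j + 1)) * (real k * fact (2 * j))"
      by (simp add: j algebra_simps)
    moreover have "2 ^ Suc j * fact (Suc j) = (2 * (real j + 1)) * (2 ^ j * fact j)"
      by (simp add: algebra_simps)
    moreover have "2 * (real j + 1) \<noteq> 0"
      by (rule less_imp_neq[symmetric]) simp
    ultimately show ?thesis
      by (simp only: mult_divide_mult_cancel_left times_divide_eq_right) simp
  qed
  also have "fact (2 * j) / (2 ^ j * fact j) = gauss_moment (k - 1)"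
    using integral_std_normal_moment_even[of "j"] j by (simp add: gauss_moment_def)
  finally show ?thesis .
qed

lemma gauss_monomial_eq:
  "gauss_density x * monomial m x = (\<Prod>i\<in>UNIV. std_normal_density (x $ i) * (x $ i) ^ m i)"
  by (simp add: gauss_density_def monomial_def prod.distrib)

lemma gauss_integrable:
  assumes "p \<in> polys"
  shows "integrable lborel (\<lambda>x. gauss_density x * p x)"
  using assms
proof (induction rule: polys_induct)
  case (step c m q)
  have "integrable lborel (\<lambda>x. gauss_density x * monomial m x)"
    unfolding gauss_monomial_eq
    by (rule lborel_product_integral) (rule integrable_std_normal_moment)
  then have "integrable lborel (\<lambda>x. c * (gauss_density x * monomial m x) + gauss_density x * q x)"
    using step by simp
  then show ?case
    by (simp add: algebra_simps)
qed simp

lemma gauss_integral_zero [simp]: "gauss_integral 0 = 0"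
  by (simp add: gauss_integral_def)

lemma gauss_integral_add:
  "p \<in> polys \<Longrightarrow> q \<in> polys \<Longrightarrow> gauss_integral (p + q) = gauss_integral p + gauss_integral q"
  by (simp add: gauss_integral_def distrib_left gauss_integrable)

lemma gauss_integral_scale: "gauss_integral (c *\<^sub>R p) = c * gauss_integral p"
  by (simp add: gauss_integral_def mult.left_commute[of _ c])

lemma gauss_integral_sum:
  "(\<And>i. i \<in> I \<Longrightarrow> f i \<in> polys) \<Longrightarrow> gauss_integral (\<Sum>i\<in>I. f i) = (\<Sum>i\<in>I. gauss_integral (f i))"
  by (induction I rule: infinite_finite_induct) (simp_all add: gauss_integral_add polys_sum)

lemma gauss_integral_monomial: "gauss_integral (monomial m) = (\<Prod>i\<in>UNIV. gauss_moment (m i))"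
  unfolding gauss_integral_def gauss_monomial_eq gauss_moment_def
  by (rule lborel_product_integral) (rule integrable_std_normal_moment)

text \<open>Integration by parts: the derivative of the Gaussian density in direction \<open>i\<close> is the density times
  \<open>- x $ i\<close>. On monomials this is the recursion for the moments.\<close>

lemma gauss_integral_coordinate_times:
  "p \<in> polys \<Longrightarrow> gauss_integral ((\<lambda>x. x $ i) * p) = gauss_integral (partial i p)"
proof (induction rule: polys_induct)
  case zero
  show "gauss_integral ((\<lambda>x. x $ i) * 0) = gauss_integral (partial i 0)"
    by (simp only: partial_zero mult_zero_right)
next
  case (step c m q)
  have eq: "(\<lambda>x. x $ i) * monomial m = monomial (m(i := Suc (m i)))"
    unfolding monomial_axis[of i, symmetric] monomial_times by (rule arg_cong[of _ _ monomial]) auto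
  have "gauss_integral (monomial (m(i := Suc (m i)))) = real (m i) * gauss_integral (monomial (m(i := m i - 1)))"
    unfolding gauss_integral_monomial
    by (subst (1 2) prod.remove[of _ i]) (auto simp: gauss_moment_Suc)
  then have *: "gauss_integral ((\<lambda>x. x $ i) * monomial m) = gauss_integral (partial i (monomial m))"
    by (simp add: eq partial_monomial gauss_integral_scale)
  have "(\<lambda>x. x $ i) * (c *\<^sub>R monomial m + q) = c *\<^sub>R ((\<lambda>x. x $ i) * monomial m) + (\<lambda>x. x $ i) * q"
    by (simp add: fun_eq_iff algebra_simps)
  moreover have "partial i (c *\<^sub>R monomial m + q) = c *\<^sub>R partial i (monomial m) + partial i q"
    using step by (simp add: partial_add partial_scale polys_scale monomial_in_polys)
  moreover have "gauss_integral ((\<lambda>x. x $ i) * q) = gauss_integral (partial i q)"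
    using step by (simp add: times_fun_def)
  ultimately show "gauss_integral ((\<lambda>x. x $ i) * (c *\<^sub>R monomial m + q)) = gauss_integral (partial i (c *\<^sub>R monomial m + q))"
    using step(1) *
    by (simp only: gauss_integral_add gauss_integral_scale polys_scale polys_times
        monomial_in_polys coordinate_in_polys partial_in_polys)
qed

text \<open>Integrating \<open>\<nabla>p \<bullet> \<nabla>q\<close> by parts moves the derivatives of \<open>q\<close> to \<open>p\<close>; the terms with a factor \<open>x $ i\<close> add up
  to a multiple of \<open>p\<close> by Euler's identity.\<close>

lemma gauss_integral_gradients:
  assumes "homogeneous_poly k p" "q \<in> polys"
  shows "(\<Sum>i\<in>UNIV. gauss_integral (partial i p * partial i q))
    = real k * gauss_integral (p * q) - gauss_integral (laplacian p * q)"
proof -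
  have p: "p \<in> polys"
    using assms(1) by (rule homogeneous_imp_polys)
  note closed = p assms(2) partial_in_polys polys_times polys_add polys_sum polys_diff coordinate_in_polys
  have "gauss_integral (partial i p * partial i q)
      = gauss_integral (((\<lambda>x. x $ i) * partial i p) * q) - gauss_integral (partial i (partial i p) * q)" for i
  proof -
    have "gauss_integral (((\<lambda>x. x $ i) * partial i p) * q) = gauss_integral (partial i (partial i p * q))"
      by (subst mult.assoc) (intro gauss_integral_coordinate_times closed)
    also have "\<dots> = gauss_integral (partial i (partial i p) * q) + gauss_integral (partial i p * partial i q)"
      by (simp add: partial_times gauss_integral_add closed)
    finally show ?thesis by simp
  qed
  then have "(\<Sum>i\<in>UNIV. gauss_integral (partial i p * partial i q))
     = gauss_integral ((\<Sum>i\<in>UNIV. (\<lambda>x. x $ i) * partial i p) * q) - gauss_integral (laplacian p * q)"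
    by (simp add: sum_subtractf sum_distrib_right laplacian_eq gauss_integral_sum closed)
  also have "(\<Sum>i\<in>UNIV. (\<lambda>x. x $ i) * partial i p) * q = real k *\<^sub>R (p * q)"
    using euler_homogeneous_poly[OF assms(1)] by (simp add: scaleR_times_fun)
  finally show ?thesis
    by (simp only: gauss_integral_scale)
qed

text \<open>The integral of \<open>\<nabla>p \<bullet> \<nabla>q\<close> is symmetric in \<open>p\<close> and \<open>q\<close>, so both ways of integrating by parts agree. For
  harmonic \<open>p\<close> and \<open>q\<close> of different degrees this gives orthogonality; the case \<open>k = l + 2\<close> yields the
  decomposition of polynomials into harmonic ones.\<close>

lemma gauss_integral_laplacian:
  assumes "homogeneous_poly k p" "homogeneous_poly l q"
  shows "gauss_integral (laplacian p * q) =
    (real k - real l) * gauss_integral (p * q) + gauss_integral (p * laplacian q)"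
proof -
  have "(\<Sum>i\<in>UNIV. gauss_integral (partial i p * partial i q))
      = (\<Sum>i\<in>UNIV. gauss_integral (partial i q * partial i p))"
    by (simp add: mult.commute)
  then have "real k * gauss_integral (p * q) - gauss_integral (laplacian p * q)
      = real l * gauss_integral (q * p) - gauss_integral (laplacian q * p)"
    using assms by (simp only: gauss_integral_gradients homogeneous_imp_polys)
  then show ?thesis
    unfolding mult.commute[of q p] mult.commute[of "laplacian q" p] by (simp add: algebra_simps)
qed

lemma homogeneous_poly_laplacian:
  "homogeneous_poly (Suc (Suc l)) p \<Longrightarrow> homogeneous_poly l (laplacian p)"
  by (simp add: laplacian_eq homogeneous_imp_polys homogeneous_poly_sum homogeneous_poly_partial)

lemma laplacian_low_degree:
  assumes "homogeneous_poly l p" "l < 2"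
  shows "laplacian p = 0"
proof -
  have "partial i (partial i p) = 0" for i
  proof (cases l)
    case 0
    then show ?thesis
      using assms by (simp add: partial_homogeneous_poly_0 partial_zero)
  next
    case (Suc k)
    then show ?thesis
      using assms homogeneous_poly_partial[of 0 p i] by (simp add: partial_homogeneous_poly_0)
  qed
  then show ?thesis
    using assms by (simp add: laplacian_eq homogeneous_imp_polys)
qed

section \<open>The surface measure and polar coordinates\<close>

lemma nn_integral_lborel_scale:
  fixes g :: "'a::euclidean_space \<Rightarrow> ennreal"
  assumes [measurable]: "g \<in> borel_measurable borel" and "t > 0"
  shows "(\<integral>\<^sup>+x. g x \<partial>lborel) = ennreal (t ^ DIM('a)) * (\<integral>\<^sup>+x. g (t *\<^sub>R x) \<partial>lborel)"
proof -
  have "(\<integral>\<^sup>+x. g x \<partial>lborel) =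
      (\<integral>\<^sup>+x. g x \<partial>density (distr lborel borel (\<lambda>x. 0 + t *\<^sub>R x)) (\<lambda>_. \<bar>t\<bar> ^ DIM('a)))"
    using assms(2) by (subst lborel_affine[of t 0]) auto
  also have "\<dots> = ennreal (t ^ DIM('a)) * (\<integral>\<^sup>+x. g (t *\<^sub>R x) \<partial>lborel)"
    using assms(2) by (simp add: nn_integral_density nn_integral_distr nn_integral_cmult)
  finally show ?thesis .
qed

lemma borel_measurable_normalize [measurable]:
  "(\<lambda>x :: 'a::euclidean_space. x /\<^sub>R norm x) \<in> borel_measurable borel"
  by measurable

text \<open>Up to the dimension as a factor, this is the integral of \<open>u\<close> over the unit sphere.\<close>

definition cone_integral :: "('a::euclidean_space \<Rightarrow> ennreal) \<Rightarrow> ennreal" where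
  "cone_integral u = (\<integral>\<^sup>+x. u (x /\<^sub>R norm x) * indicator (cball 0 1 - {0}) x \<partial>lborel)"

lemma nn_integral_lborel_minus_singleton:
  fixes g :: "'a::euclidean_space \<Rightarrow> ennreal"
  shows "(\<integral>\<^sup>+x. g x * indicator (A - {c}) x \<partial>lborel) = (\<integral>\<^sup>+x. g x * indicator A x \<partial>lborel)"
  using AE_lborel_singleton[of c] by (intro nn_integral_cong_AE) (auto split: split_indicator)

lemma nn_integral_cone_cball:
  fixes u :: "'a::euclidean_space \<Rightarrow> ennreal"
  assumes [measurable]: "u \<in> borel_measurable borel"
  shows "(\<integral>\<^sup>+x. u (x /\<^sub>R norm x) * indicator (cball 0 t) x \<partial>lborel) =
    ennreal ((max 0 t) ^ DIM('a)) * cone_integral u"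
proof (cases "t > 0")
  case True
  have [measurable]: "cball (0 :: 'a) t \<in> sets borel"
    by simp
  have "(\<integral>\<^sup>+x. u (x /\<^sub>R norm x) * indicator (cball 0 t) x \<partial>lborel) =
      ennreal (t ^ DIM('a)) * (\<integral>\<^sup>+x. u ((t *\<^sub>R x) /\<^sub>R norm (t *\<^sub>R x)) * indicator (cball 0 t) (t *\<^sub>R x) \<partial>lborel)"
    using True by (intro nn_integral_lborel_scale) measurable
  also have "(\<lambda>x. u ((t *\<^sub>R x) /\<^sub>R norm (t *\<^sub>R x)) * indicator (cball 0 t) (t *\<^sub>R x)) =
      (\<lambda>x :: 'a. u (x /\<^sub>R norm x) * indicator (cball 0 1) x)"
  proof -
    have "(t *\<^sub>R x) /\<^sub>R norm (t *\<^sub>R x) = x /\<^sub>R norm x" for x :: 'a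
    proof -
      have "inverse (t * norm x) * t = inverse (norm x)"
        using True by (simp add: field_simps)
      then show ?thesis
        using True by simp
    qed
    then show ?thesis
      using True by (auto simp only: fun_eq_iff) (auto split: split_indicator)
  qed
  finally show ?thesis
    using True by (simp add: cone_integral_def nn_integral_lborel_minus_singleton)
next
  case False
  have "(\<integral>\<^sup>+x. u (x /\<^sub>R norm x) * indicator (cball 0 t) x \<partial>lborel) = (\<integral>\<^sup>+x. 0 \<partial>(lborel :: 'a measure))"
  proof (intro nn_integral_cong_AE eventually_mono[OF AE_lborel_singleton[of 0]])
    fix x :: 'a assume "x \<noteq> 0"
    then have "x \<notin> cball 0 t"
      using False by (smt (verit) mem_cball_0 zero_less_norm_iff)
    then show "u (x /\<^sub>R norm x) * indicator (cball 0 t) x = 0"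
      by simp
  qed
  then show ?thesis
    using False by simp
qed

lemma cone_integral_one:
  "0 < cone_integral (\<lambda>_ :: 'a::euclidean_space. 1)" "cone_integral (\<lambda>_ :: 'a. 1) < \<infinity>"
proof -
  have eq: "cone_integral (\<lambda>_ :: 'a. 1) = emeasure lborel (cball (0 :: 'a) 1)"
    by (simp add: cone_integral_def nn_integral_lborel_minus_singleton[of "\<lambda>_. 1", simplified])
  show "cone_integral (\<lambda>_ :: 'a. 1) < \<infinity>"
    unfolding eq using emeasure_lborel_cball_finite by simp
  have "0 < measure lborel (cball (0 :: 'a) 1)"
    by (rule content_cball_pos) simp
  then show "0 < cone_integral (\<lambda>_ :: 'a. 1)"
    unfolding eq by (auto simp: measure_def enn2real_positive_iff)
qed

text \<open>Polar coordinates in product form. By scaling, the mass that Lebesgue measure, weighted by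
  \<open>u\<close> along rays, gives to the ball of radius \<open>t\<close> is \<open>t\<^sup>n\<close> times a constant, where \<open>n\<close>
  is the dimension, so the push-forwards of these measures under the norm are proportional for all \<open>u\<close>. Multiplying both sides by the constants avoids a quotient of
  extended reals.\<close>

lemma nn_integral_polar:
  fixes u :: "'a::euclidean_space \<Rightarrow> ennreal"
  assumes [measurable]: "u \<in> borel_measurable borel" "\<phi> \<in> borel_measurable borel"
    and fin: "cone_integral u < \<infinity>"
  shows "cone_integral (\<lambda>_ :: 'a. 1) * (\<integral>\<^sup>+x. u (x /\<^sub>R norm x) * \<phi> (norm x) \<partial>lborel) =
    cone_integral u * (\<integral>\<^sup>+x. \<phi> (norm x) \<partial>(lborel :: 'a measure))"
proof -
  define \<nu> where "\<nu> v = distr (density lborel (\<lambda>x :: 'a. v (x /\<^sub>R norm x))) borel norm" for v :: "'a \<Rightarrow> ennreal"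
  have sets: "sets (\<nu> v) = sets borel" for v
    by (simp add: \<nu>_def)
  have int: "(\<integral>\<^sup>+r. \<phi> r \<partial>\<nu> v) = (\<integral>\<^sup>+x. v (x /\<^sub>R norm x) * \<phi> (norm x) \<partial>lborel)"
    if [measurable]: "v \<in> borel_measurable borel" for v
    unfolding \<nu>_def by (subst nn_integral_distr, simp, simp, subst nn_integral_density) auto
  have em: "emeasure (\<nu> v) {..t} = ennreal ((max 0 t) ^ DIM('a)) * cone_integral v"
    if [measurable]: "v \<in> borel_measurable borel" for v t
  proof -
    have "norm -` {..t} = cball (0 :: 'a) t"
      by auto
    then have "emeasure (\<nu> v) {..t} = (\<integral>\<^sup>+x. v (x /\<^sub>R norm x) * indicator (cball 0 t) x \<partial>lborel)"
      unfolding \<nu>_def by (subst emeasure_distr, simp, simp, subst emeasure_density) auto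
    then show ?thesis
      by (simp only: nn_integral_cone_cball[OF that])
  qed
  note fin1 = cone_integral_one(2)[where 'a = 'a]
  have "scale_measure (cone_integral (\<lambda>_ :: 'a. 1)) (\<nu> u) = scale_measure (cone_integral u) (\<nu> (\<lambda>_. 1))"
  proof (rule measure_eqI_generator_eq[where \<Omega> = UNIV and E = "range (\<lambda>a :: real. {..a})" and A = "\<lambda>n :: nat. {..real n}"])
    show "Int_stable (range (\<lambda>a :: real. {..a}))"
      by (auto simp: Int_stable_def)
    fix X assume "X \<in> range (\<lambda>a :: real. {..a})"
    then show "emeasure (scale_measure (cone_integral (\<lambda>_ :: 'a. 1)) (\<nu> u)) X =
        emeasure (scale_measure (cone_integral u) (\<nu> (\<lambda>_. 1))) X"
      by (auto simp: em mult_ac)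
  next
    have "sets (borel :: real measure) = sigma_sets UNIV (range (\<lambda>a :: real. {..a}))"
      by (subst borel_eq_atMost) simp
    then show "sets (scale_measure (cone_integral (\<lambda>_ :: 'a. 1)) (\<nu> u)) = sigma_sets UNIV (range (\<lambda>a :: real. {..a}))"
      "sets (scale_measure (cone_integral u) (\<nu> (\<lambda>_. 1))) = sigma_sets UNIV (range (\<lambda>a :: real. {..a}))"
      by (simp_all add: sets)
  next
    show "(\<Union>n :: nat. {..real n}) = UNIV"
      using real_arch_simple by auto
    show "emeasure (scale_measure (cone_integral (\<lambda>_ :: 'a. 1)) (\<nu> u)) {..real n} \<noteq> \<infinity>" for n
      using fin fin1 by (auto simp: em ennreal_mult_eq_top_iff)
  qed auto
  then have "(\<integral>\<^sup>+r. \<phi> r \<partial>scale_measure (cone_integral (\<lambda>_ :: 'a. 1)) (\<nu> u)) =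
      (\<integral>\<^sup>+r. \<phi> r \<partial>scale_measure (cone_integral u) (\<nu> (\<lambda>_. 1)))"
    by simp
  moreover have "\<phi> \<in> borel_measurable (\<nu> v)" for v
    by (simp add: \<nu>_def)
  ultimately show ?thesis
    by (simp add: nn_integral_scale_measure int)
qed

lemma space_sphere_measure [simp]: "space sphere_measure = sphere 0 1"
  by (simp add: sphere_measure_def space_scale_measure space_restrict_space)

lemma sets_sphere_measure [measurable_cong]: "sets sphere_measure = sets (restrict_space borel (sphere 0 1))"
  by (simp add: sphere_measure_def)

lemma measurable_normalize_sphere:
  "(\<lambda>x :: 'a::euclidean_space. x /\<^sub>R norm x) \<in> measurable (restrict_space lborel (cball 0 1 - {0})) (restrict_space borel (sphere 0 1))"
  by (intro measurable_restrict_space2 measurable_restrict_space1)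
     (auto simp: space_restrict_space)

lemma borel_measurable_sphere:
  "f \<in> borel_measurable borel \<Longrightarrow> f \<in> borel_measurable sphere_measure"
  by (subst measurable_cong_sets[OF sets_sphere_measure refl]) (rule measurable_restrict_space1)

lemma sphere_measure_eq:
  "(sphere_measure :: (real ^ 'd::finite) measure) = density
     (distr (restrict_space lborel (cball 0 1 - {0})) (restrict_space borel (sphere 0 1))
       (\<lambda>x. x /\<^sub>R norm x)) (\<lambda>_. ennreal (real CARD('d)))"
  unfolding sphere_measure_def
  by (rule measure_eqI) (simp_all add: emeasure_density_const ennreal_of_nat_eq_real_of_nat)

lemma nn_integral_sphere:
  assumes "f \<in> borel_measurable (sphere_measure :: (real ^ 'd::finite) measure)"
  shows "(\<integral>\<^sup>+w. f w \<partial>sphere_measure) = ennreal (real CARD('d)) * cone_integral f"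
proof -
  have f: "f \<in> borel_measurable (restrict_space borel (sphere 0 1))"
    using assms by (simp only: measurable_cong_sets[OF sets_sphere_measure refl])
  show ?thesis
    unfolding sphere_measure_eq
    using f measurable_normalize_sphere[where 'a = "real ^ 'd"]
    by (simp add: nn_integral_density nn_integral_cmult nn_integral_distr nn_integral_restrict_space
        cone_integral_def)
qed

interpretation sphere_measure: finite_measure "sphere_measure :: (real ^ 'd::finite) measure"
proof
  have "emeasure (sphere_measure :: (real ^ 'd) measure) (sphere 0 1) =
      (\<integral>\<^sup>+w. 1 \<partial>(sphere_measure :: (real ^ 'd) measure))"
    by simp
  also have "\<dots> < \<infinity>"
    using cone_integral_one(2)[where 'a = "real ^ 'd"]
    by (subst nn_integral_sphere) (simp_all add: ennreal_mult_less_top)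
  finally show "emeasure (sphere_measure :: (real ^ 'd) measure) (space sphere_measure) \<noteq> \<infinity>"
    by simp
qed

section \<open>Bounded measurable functions on the sphere\<close>

text \<open>Harmonics, rounded harmonics and their combinations are all bounded, so square integrability never
  needs a separate argument in this space.\<close>

definition bounded_sphere :: "(real ^ 'd::finite \<Rightarrow> real) set" where
  "bounded_sphere = {f. f \<in> borel_measurable sphere_measure \<and> (\<exists>C. \<forall>w\<in>sphere 0 1. \<bar>f w\<bar> \<le> C)}"

lemma bounded_sphereI:
  "f \<in> borel_measurable sphere_measure \<Longrightarrow> (\<And>w. w \<in> sphere 0 1 \<Longrightarrow> \<bar>f w\<bar> \<le> C) \<Longrightarrow> f \<in> bounded_sphere"
  unfolding bounded_sphere_def by blast

lemma subspace_bounded_sphere: "subspace bounded_sphere"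
proof (rule subspaceI)
  show "0 \<in> bounded_sphere"
    by (rule bounded_sphereI[where C = 0]) (simp_all add: zero_fun_def)
next
  fix f g :: "real ^ 'd::finite \<Rightarrow> real" assume fg: "f \<in> bounded_sphere" "g \<in> bounded_sphere"
  then obtain C D where *: "\<And>w. w \<in> sphere 0 1 \<Longrightarrow> \<bar>f w\<bar> \<le> C" "\<And>w. w \<in> sphere 0 1 \<Longrightarrow> \<bar>g w\<bar> \<le> D"
    unfolding bounded_sphere_def by blast
  show "f + g \<in> bounded_sphere"
  proof (rule bounded_sphereI[where C = "C + D"])
    show "f + g \<in> borel_measurable sphere_measure"
      using fg by (auto simp: bounded_sphere_def plus_fun_def)
    show "\<bar>(f + g) w\<bar> \<le> C + D" if "w \<in> sphere 0 1" for w
      using *[OF that] by simp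
  qed
next
  fix f :: "real ^ 'd::finite \<Rightarrow> real" and c assume f: "f \<in> bounded_sphere"
  then obtain C where *: "\<And>w. w \<in> sphere 0 1 \<Longrightarrow> \<bar>f w\<bar> \<le> C"
    unfolding bounded_sphere_def by blast
  show "c *\<^sub>R f \<in> bounded_sphere"
  proof (rule bounded_sphereI[where C = "\<bar>c\<bar> * C"])
    show "c *\<^sub>R f \<in> borel_measurable sphere_measure"
      using f by (auto simp: bounded_sphere_def scaleR_fun_def)
    show "\<bar>(c *\<^sub>R f) w\<bar> \<le> \<bar>c\<bar> * C" if "w \<in> sphere 0 1" for w
      using *[OF that] by (simp add: abs_mult mult_left_mono)
  qed
qed

lemma bounded_sphere_times:
  assumes "f \<in> bounded_sphere" "g \<in> bounded_sphere"
  shows "f * g \<in> bounded_sphere"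
proof -
  obtain C D where *: "\<And>w. w \<in> sphere 0 1 \<Longrightarrow> \<bar>f w\<bar> \<le> C" "\<And>w. w \<in> sphere 0 1 \<Longrightarrow> \<bar>g w\<bar> \<le> D"
    using assms unfolding bounded_sphere_def by blast
  show ?thesis
  proof (rule bounded_sphereI[where C = "C * D"])
    show "f * g \<in> borel_measurable sphere_measure"
      using assms by (auto simp: bounded_sphere_def times_fun_def)
    show "\<bar>(f * g) w\<bar> \<le> C * D" if "w \<in> sphere 0 1" for w
      using *(1)[OF that] *(2)[OF that] by (simp add: abs_mult mult_mono')
  qed
qed

lemma bounded_sphere_integrable: "f \<in> bounded_sphere \<Longrightarrow> integrable sphere_measure f"
  unfolding bounded_sphere_def
  by (auto intro!: sphere_measure.integrable_const_bound AE_I2)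

lemma bounded_sphere_times_integrable:
  "f \<in> bounded_sphere \<Longrightarrow> g \<in> bounded_sphere \<Longrightarrow> integrable sphere_measure (\<lambda>w. f w * g w)"
  using bounded_sphere_integrable[OF bounded_sphere_times, of f g] by (simp add: times_fun_def)

lemma bounded_sphere_subset_L2: "bounded_sphere \<subseteq> L2_sphere"
  using bounded_sphere_times_integrable
  by (auto simp: L2_sphere_def power2_eq_square) (auto simp: bounded_sphere_def)

interpretation sphere: semi_inner_space "bounded_sphere :: (real ^ 'd::finite \<Rightarrow> real) set" inner_sphere
  rewrites "semi_inner_space.seminorm inner_sphere = norm_sphere"
proof -
  show *: "semi_inner_space (bounded_sphere :: (real ^ 'd::finite \<Rightarrow> real) set) inner_sphere"
  proof
    show "subspace (bounded_sphere :: (real ^ 'd::finite \<Rightarrow> real) set)"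
      by (rule subspace_bounded_sphere)
    show "inner_sphere f g = inner_sphere g f" for f g :: "real ^ 'd \<Rightarrow> real"
      by (simp add: inner_sphere_def mult.commute)
  qed (simp_all add: inner_sphere_def bounded_sphere_times_integrable distrib_right mult.assoc)
  show "semi_inner_space.seminorm inner_sphere = (norm_sphere :: (real ^ 'd::finite \<Rightarrow> real) \<Rightarrow> real)"
    by (simp add: fun_eq_iff semi_inner_space.seminorm_def[OF *] norm_sphere_def)
qed

lemma inner_sphere_cong:
  "(\<And>w. w \<in> sphere 0 1 \<Longrightarrow> f w = f' w) \<Longrightarrow> (\<And>w. w \<in> sphere 0 1 \<Longrightarrow> g w = g' w) \<Longrightarrow>
    inner_sphere f g = inner_sphere f' g'"
  unfolding inner_sphere_def by (rule Bochner_Integration.integral_cong) auto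

lemma continuous_bounded_sphere:
  assumes "continuous_on (sphere 0 1) f"
  shows "f \<in> bounded_sphere"
proof -
  have "compact (f ` sphere 0 1)"
    by (rule compact_continuous_image[OF assms]) auto
  from compact_imp_bounded[OF this]
  obtain C where C: "\<And>w. w \<in> sphere 0 1 \<Longrightarrow> \<bar>f w\<bar> \<le> C"
    unfolding bounded_iff by fastforce
  have "f \<in> borel_measurable sphere_measure"
    by (subst measurable_cong_sets[OF sets_sphere_measure refl])
       (rule borel_measurable_continuous_on_restrict[OF assms])
  then show ?thesis
    using C by (rule bounded_sphereI)
qed

lemma restrict_sphere_bounded:
  assumes "f \<in> bounded_sphere"
  shows "restrict_sphere f \<in> bounded_sphere"
proof -
  have "restrict_sphere f \<in> borel_measurable sphere_measure"
    using assms by (subst measurable_cong[of _ _ f]) (auto simp: restrict_sphere_def bounded_sphere_def)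
  then show ?thesis
    using assms by (auto simp: bounded_sphere_def restrict_sphere_def)
qed

lemma poly_bounded_sphere: "p \<in> polys \<Longrightarrow> p \<in> bounded_sphere"
  by (rule continuous_bounded_sphere[OF continuous_on_poly])

text \<open>If \<open>p w \<noteq> 0\<close>, the extension of \<open>p\<close> that is constant on rays is nonzero on a nonempty open subset of
  the ball, which has positive volume.\<close>

lemma poly_norm_zero_imp:
  assumes p: "p \<in> polys" and "inner_sphere p p = 0" and w: "w \<in> sphere 0 1"
  shows "p w = 0"
proof (rule ccontr)
  assume pw: "p w \<noteq> 0"
  have cont: "continuous_on S p" for S
    using p by (rule continuous_on_poly)
  have [measurable]: "p \<in> borel_measurable borel"
    by (rule borel_measurable_continuous_onI[OF cont])
  have int: "integrable sphere_measure (\<lambda>w. p w * p w)"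
    using p by (intro bounded_sphere_times_integrable poly_bounded_sphere)
  have "AE w in sphere_measure. p w * p w = 0"
    using assms(2) integral_nonneg_eq_0_iff_AE[OF int] by (simp add: inner_sphere_def)
  then have "(\<integral>\<^sup>+w. ennreal (\<bar>p w\<bar>) \<partial>sphere_measure) = (\<integral>\<^sup>+w. 0 \<partial>(sphere_measure :: (real ^ 'a) measure))"
    by (intro nn_integral_cong_AE) auto
  moreover have "(\<lambda>w. ennreal \<bar>p w\<bar>) \<in> borel_measurable sphere_measure"
    by (rule borel_measurable_sphere) measurable
  ultimately have "cone_integral (\<lambda>w. ennreal \<bar>p w\<bar>) = 0"
    by (simp add: nn_integral_sphere)
  moreover have [measurable]: "cball 0 1 - {0 :: real ^ 'a} \<in> sets borel"
    by simp
  ultimately have "AE x in lborel. ennreal \<bar>p (x /\<^sub>R norm x)\<bar> * indicator (cball 0 1 - {0}) x = 0"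
    unfolding cone_integral_def by (subst (asm) nn_integral_0_iff_AE) simp_all
  then have ae: "AE x in lborel. x \<notin> {x. x \<in> ball 0 1 - {0} \<and> p (x /\<^sub>R norm x) \<noteq> 0}"
    by (rule eventually_mono) (auto split: split_indicator_asm)
  have "open ((ball 0 1 - {0}) \<inter> (\<lambda>x. p (x /\<^sub>R norm x)) -` (- {0}))"
    by (intro continuous_open_preimage continuous_on_compose2[OF cont[of UNIV]] continuous_intros) auto
  also have "(ball 0 1 - {0}) \<inter> (\<lambda>x. p (x /\<^sub>R norm x)) -` (- {0}) = {x. x \<in> ball 0 1 - {0} \<and> p (x /\<^sub>R norm x) \<noteq> 0}"
    by auto
  finally have op: "open {x. x \<in> ball 0 1 - {0} \<and> p (x /\<^sub>R norm x) \<noteq> 0}" (is "open ?U") .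
  moreover have "(1 / 2) *\<^sub>R w \<in> ?U"
    using w pw by auto
  ultimately have "\<not> negligible ?U"
    by (metis (no_types, lifting) open_not_negligible empty_iff)
  moreover have "?U \<in> null_sets lborel"
    using ae op by (subst AE_iff_null_sets) auto
  ultimately show False
    by (simp add: negligible_iff_null_sets null_sets_completionI)
qed

lemma gauss_density_radial:
  "gauss_density (x :: real ^ 'd::finite) = (1 / sqrt (2 * pi)) ^ CARD('d) * exp (- (norm x)\<^sup>2 / 2)"
proof -
  have "gauss_density x = (\<Prod>i\<in>(UNIV :: 'd set). 1 / sqrt (2 * pi)) * (\<Prod>i\<in>UNIV. exp (- (x $ i)\<^sup>2 / 2))"
    unfolding gauss_density_def std_normal_density_def by (rule prod.distrib)
  also have "(\<Prod>i\<in>UNIV. exp (- (x $ i)\<^sup>2 / 2)) = exp (\<Sum>i\<in>UNIV. - (x $ i)\<^sup>2 / 2)"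
    by (simp add: exp_sum)
  also have "(\<Sum>i\<in>UNIV. - (x $ i)\<^sup>2 / 2) = - (norm x)\<^sup>2 / 2"
    by (simp add: norm_vec_def L2_set_def sum_nonneg sum_negf sum_divide_distrib)
  finally show ?thesis by simp
qed

text \<open>In polar coordinates the integrand is the product of \<open>p\<close> on the sphere and a radial function that
  depends only on the degree. Polar coordinates are available for nonnegative functions, so \<open>p\<close> and \<open>- p\<close>
  are treated separately.\<close>

lemma gauss_integral_homogeneous:
  "\<exists>c > 0. \<forall>p :: real ^ 'd::finite \<Rightarrow> real. homogeneous_poly m p \<longrightarrow>
     gauss_integral p = c * (LINT w|sphere_measure. p w)"
proof -
  define \<phi> where "\<phi> r = (1 / sqrt (2 * pi)) ^ CARD('d) * exp (- r\<^sup>2 / 2) * \<bar>r\<bar> ^ m" for r :: real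
  have phi0: "0 \<le> \<phi> r" for r
    by (simp add: \<phi>_def)
  have [measurable]: "\<phi> \<in> borel_measurable borel"
    unfolding \<phi>_def by measurable
  define K where "K = (\<integral>\<^sup>+x. ennreal (\<phi> (norm x)) \<partial>(lborel :: (real ^ 'd) measure))"
  define V where "V = cone_integral (\<lambda>_ :: real ^ 'd. 1)"
  have V: "0 < V" "V < \<infinity>"
    unfolding V_def by (rule cone_integral_one)+
  have polar: "V * (\<integral>\<^sup>+x. ennreal (gauss_density x * p x) \<partial>lborel) * ennreal (real CARD('d))
      = (\<integral>\<^sup>+w. ennreal (p w) \<partial>sphere_measure) * K"
    if p: "homogeneous_poly m p" for p :: "real ^ 'd \<Rightarrow> real"
  proof -
    have [measurable]: "p \<in> borel_measurable borel"
      by (intro borel_measurable_continuous_onI continuous_on_poly homogeneous_imp_polys[OF p])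
    have meas: "(\<lambda>w. ennreal (p w)) \<in> borel_measurable sphere_measure"
      by (rule borel_measurable_sphere) measurable
    have "integrable sphere_measure p"
      by (intro bounded_sphere_integrable poly_bounded_sphere homogeneous_imp_polys[OF p])
    then have "(\<integral>\<^sup>+w. ennreal (p w) \<partial>sphere_measure) < \<infinity>"
      by (auto simp: real_integrable_def less_top)
    then have "cone_integral (\<lambda>w. ennreal (p w)) < \<infinity>"
      by (auto simp: nn_integral_sphere[OF meas] ennreal_mult_less_top)
    moreover have "(\<integral>\<^sup>+x. ennreal (gauss_density x * p x) \<partial>lborel) =
        (\<integral>\<^sup>+x. ennreal (p (x /\<^sub>R norm x)) * ennreal (\<phi> (norm x)) \<partial>lborel)"
    proof (intro nn_integral_cong_AE eventually_mono[OF AE_lborel_singleton[of 0]])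
      fix x :: "real ^ 'd" assume x: "x \<noteq> 0"
      have "p x = norm x ^ m * p (x /\<^sub>R norm x)"
        using homogeneous_poly_scale_arg[OF p, of "norm x" "x /\<^sub>R norm x"] x by simp
      then have "gauss_density x * p x = p (x /\<^sub>R norm x) * \<phi> (norm x)"
        by (simp add: gauss_density_radial \<phi>_def)
      then show "ennreal (gauss_density x * p x) = ennreal (p (x /\<^sub>R norm x)) * ennreal (\<phi> (norm x))"
        using phi0 by (simp add: ennreal_mult'')
    qed
    ultimately show ?thesis
      using nn_integral_polar[of "\<lambda>w. ennreal (p w)" "\<lambda>r. ennreal (\<phi> r)"]
      by (simp add: K_def V_def nn_integral_sphere[OF meas] mult_ac)
  qed
  \<comment> \<open>The radial integral \<open>K\<close> is positive and finite; for the latter, it is bounded by Gaussian integrals of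
    even powers of the norm, which are polynomials.\<close>
  have K0: "K \<noteq> 0"
  proof
    assume "K = 0"
    then have "AE x in (lborel :: (real ^ 'd) measure). ennreal (\<phi> (norm x)) = 0"
      unfolding K_def by (subst (asm) nn_integral_0_iff_AE) auto
    with AE_lborel_singleton[of "0 :: real ^ 'd"] have "AE x in (lborel :: (real ^ 'd) measure). False"
    proof eventually_elim
      case (elim x)
      then have "0 < \<phi> (norm x)"
        by (simp add: \<phi>_def)
      then show ?case using elim by simp
    qed
    then show False
      by (simp add: AE_iff_measurable[OF _ refl])
  qed
  have "(\<integral>\<^sup>+x. ennreal (\<phi> (norm x)) \<partial>(lborel :: (real ^ 'd) measure)) < \<infinity>"
  proof -
    have pow: "(\<lambda>x :: real ^ 'd. ((norm x)\<^sup>2) ^ k) \<in> polys" for k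
    proof (induction k)
      case 0
      have "real_polynomial_function (\<lambda>x :: real ^ 'd. 1 :: real)" by blast
      then show ?case by (simp add: real_polynomial_function_imp_polys)
    next
      case (Suc k)
      then show ?case
        using polys_times[OF homogeneous_imp_polys[OF homogeneous_poly_norm_square] Suc]
        by (simp add: times_fun_def)
    qed
    have int: "integrable lborel (\<lambda>x :: real ^ 'd. gauss_density x * (((norm x)\<^sup>2) ^ 0 + ((norm x)\<^sup>2) ^ m))"
      using polys_add[OF pow[of 0] pow[of m]] by (intro gauss_integrable) (simp add: plus_fun_def)
    have "\<phi> (norm x) \<le> gauss_density x * (((norm x)\<^sup>2) ^ 0 + ((norm x)\<^sup>2) ^ m)" for x :: "real ^ 'd"
    proof -
      have "2 * norm x ^ m \<le> 1 + (norm x ^ m)\<^sup>2"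
        using sum_power2_ge_zero[of "norm x ^ m - 1" 0] by (simp add: power2_diff)
      then have "norm x ^ m \<le> 1 + (norm x ^ m)\<^sup>2"
        using zero_le_power[OF norm_ge_zero, of x m] by linarith
      then show ?thesis
        unfolding gauss_density_radial \<phi>_def
        by (simp add: mult.assoc power_mult[symmetric] mult.commute[of 2 m] mult_left_mono)
    qed
    then have "(\<integral>\<^sup>+x. ennreal (\<phi> (norm x)) \<partial>(lborel :: (real ^ 'd) measure)) \<le>
       (\<integral>\<^sup>+x. ennreal (gauss_density x * (((norm x)\<^sup>2) ^ 0 + ((norm x)\<^sup>2) ^ m)) \<partial>(lborel :: (real ^ 'd) measure))"
      by (intro nn_integral_mono ennreal_leI)
    also have "\<dots> < \<infinity>"
      using int by (auto simp: real_integrable_def less_top)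
    finally show ?thesis .
  qed
  then have K: "K < \<infinity>" by (simp add: K_def)
  define c where "c = enn2real K / (enn2real V * real CARD('d))"
  have "0 < c"
    using K K0 V by (auto simp: c_def enn2real_positive_iff zero_less_iff_neq_zero less_top)
  moreover have "gauss_integral p = c * (LINT w|sphere_measure. p w)" if p: "homogeneous_poly m p" for p :: "real ^ 'd \<Rightarrow> real"
  proof -
    have real: "enn2real (\<integral>\<^sup>+x. ennreal (gauss_density x * q x) \<partial>lborel) = c * enn2real (\<integral>\<^sup>+w. ennreal (q w) \<partial>sphere_measure)"
      if q: "homogeneous_poly m q" for q :: "real ^ 'd \<Rightarrow> real"
    proof -
      have "enn2real V * enn2real (\<integral>\<^sup>+x. ennreal (gauss_density x * q x) \<partial>lborel) * real CARD('d)
        = enn2real (\<integral>\<^sup>+w. ennreal (q w) \<partial>sphere_measure) * enn2real K"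
        using arg_cong[OF polar[OF q], of enn2real] by (simp add: enn2real_mult)
      moreover have "enn2real V \<noteq> 0"
        using V by (simp add: enn2real_eq_0_iff less_top)
      ultimately show ?thesis
        by (simp add: c_def field_simps)
    qed
    have "integrable lborel (\<lambda>x. gauss_density x * p x)"
      by (rule gauss_integrable[OF homogeneous_imp_polys[OF p]])
    moreover have "integrable sphere_measure p"
      by (intro bounded_sphere_integrable poly_bounded_sphere homogeneous_imp_polys[OF p])
    moreover have "homogeneous_poly m (- p)"
      using homogeneous_poly_scale[OF p, of "-1"] by simp
    from real[OF this] have "enn2real (\<integral>\<^sup>+x. ennreal (- (gauss_density x * p x)) \<partial>lborel) = c * enn2real (\<integral>\<^sup>+w. ennreal (- p w) \<partial>sphere_measure)"
      by (simp add: fun_Compl_def)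
    ultimately show ?thesis
      unfolding gauss_integral_def
      by (simp add: real_lebesgue_integral_def real[OF p] right_diff_distrib)
  qed
  ultimately show ?thesis by blast
qed

section \<open>Spherical harmonics\<close>

lemma linear_restrict_sphere: "linear restrict_sphere"
  by (rule linearI) (auto simp: restrict_sphere_def fun_eq_iff)

lemma linear_times_left: "linear (\<lambda>q :: 'a \<Rightarrow> real. p * q)"
  by (rule linearI) (simp_all add: distrib_left scaleR_times_fun)

definition harmonic_polys :: "nat \<Rightarrow> (real ^ 'd::finite \<Rightarrow> real) set" where
  "harmonic_polys l = {p. homogeneous_poly l p \<and> laplacian p = 0}"

lemma sph_harmonics_eq: "sph_harmonics l = restrict_sphere ` harmonic_polys l"
  by (auto simp: sph_harmonics_def harmonic_polys_def fun_eq_iff)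

lemma subspace_harmonic_polys: "subspace (harmonic_polys l)"
proof (rule subspaceI)
  have "laplacian 0 = (0 :: real ^ 'a \<Rightarrow> real)"
    by (simp only: laplacian_eq polys_zero partial_zero sum.neutral_const)
  then show "(0 :: real ^ 'a \<Rightarrow> real) \<in> harmonic_polys l"
    by (simp add: harmonic_polys_def homogeneous_poly_zero)
next
  fix p q :: "real ^ 'a \<Rightarrow> real" assume pq: "p \<in> harmonic_polys l" "q \<in> harmonic_polys l"
  then have "p \<in> polys" "q \<in> polys"
    by (auto simp: harmonic_polys_def intro: homogeneous_imp_polys)
  then have "laplacian (p + q) = laplacian p + laplacian q"
    by (simp add: laplacian_eq polys_add partial_add partial_in_polys sum.distrib)
  then show "p + q \<in> harmonic_polys l"
    using pq by (simp add: harmonic_polys_def homogeneous_poly_add)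
next
  fix p :: "real ^ 'a \<Rightarrow> real" and c assume p: "p \<in> harmonic_polys l"
  then have "p \<in> polys"
    by (auto simp: harmonic_polys_def intro: homogeneous_imp_polys)
  then have "laplacian (c *\<^sub>R p) = c *\<^sub>R laplacian p"
    by (simp add: laplacian_eq polys_scale partial_scale partial_in_polys scaleR_sum_right)
  then show "c *\<^sub>R p \<in> harmonic_polys l"
    using p by (simp add: harmonic_polys_def homogeneous_poly_scale)
qed

lemma subspace_sph_harmonics: "subspace (sph_harmonics l)"
  unfolding sph_harmonics_eq
  by (rule linear_subspace_image[OF linear_restrict_sphere subspace_harmonic_polys])

lemma sph_harmonics_bounded: "sph_harmonics l \<subseteq> bounded_sphere"
  unfolding sph_harmonics_eq harmonic_polys_def
  using homogeneous_imp_polys by (blast intro: restrict_sphere_bounded poly_bounded_sphere)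

lemma sph_harmonics_basis:
  obtains B where "finite B" "independent B" "B \<subseteq> sph_harmonics l"
    "span B = (sph_harmonics l :: (real ^ 'd::finite \<Rightarrow> real) set)" "card B = alpha TYPE('d) l"
proof -
  obtain B where B: "B \<subseteq> (sph_harmonics l :: (real ^ 'd \<Rightarrow> real) set)" "independent B"
      "sph_harmonics l \<subseteq> span B" "card B = dim (sph_harmonics l :: (real ^ 'd \<Rightarrow> real) set)"
    using basis_exists by blast
  have "harmonic_polys l \<subseteq> span (monomial ` {m :: 'd \<Rightarrow> nat. (\<Sum>i\<in>UNIV. m i) = l})"
    by (auto simp: harmonic_polys_def simp flip: homogeneous_poly_eq_span)
  then have "sph_harmonics l \<subseteq> span (restrict_sphere ` monomial ` {m :: 'd \<Rightarrow> nat. (\<Sum>i\<in>UNIV. m i) = l})"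
    unfolding sph_harmonics_eq span_linear_image[OF linear_restrict_sphere] by (rule image_mono)
  then have "B \<subseteq> span (restrict_sphere ` monomial ` {m :: 'd \<Rightarrow> nat. (\<Sum>i\<in>UNIV. m i) = l})"
    using B(1) by blast
  from independent_span_bound[OF _ B(2) this] have "finite B"
    by (simp add: finite_exponents)
  moreover have "span B = sph_harmonics l"
    using B(1,3) span_minimal[OF _ subspace_sph_harmonics] by blast
  ultimately show thesis
    using B that by (simp add: alpha_def)
qed

lemma inner_sphere_restrict: "inner_sphere (restrict_sphere p) (restrict_sphere q) = inner_sphere p q"
  by (rule inner_sphere_cong) (simp_all add: restrict_sphere_def)

lemma gauss_integral_inner_sphere:
  assumes "homogeneous_poly k p" "homogeneous_poly l q"
  shows "gauss_integral (p * q) = 0 \<longleftrightarrow> inner_sphere p q = 0"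
  using gauss_integral_homogeneous[of "k + l"] homogeneous_poly_times[OF assms]
  by (auto simp: inner_sphere_def)

lemma sph_harmonics_orthogonal:
  assumes "k \<noteq> l" "u \<in> sph_harmonics k" "v \<in> sph_harmonics l"
  shows "inner_sphere u v = 0"
proof -
  obtain p q where u: "u = restrict_sphere p" and p: "homogeneous_poly k p" "laplacian p = 0"
    and v: "v = restrict_sphere q" and q: "homogeneous_poly l q" "laplacian q = 0"
    using assms(2,3) by (auto simp: sph_harmonics_eq harmonic_polys_def)
  have "(real k - real l) * gauss_integral (p * q) = 0"
    using gauss_integral_laplacian[OF p(1) q(1)] p(2) q(2)
    by (simp only: mult_zero_left mult_zero_right gauss_integral_zero add_0_right)
  then have "gauss_integral (p * q) = 0"
    using assms(1) by simp
  then show ?thesis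
    using gauss_integral_inner_sphere[OF p(1) q(1)] by (simp add: u v inner_sphere_restrict)
qed

lemma homogeneous_poly_zero_on_sphere:
  fixes p :: "real ^ 'd::finite \<Rightarrow> real"
  assumes p: "homogeneous_poly l p" and "\<And>w. w \<in> sphere 0 1 \<Longrightarrow> p w = 0"
  shows "p = 0"
proof
  fix x :: "real ^ 'd"
  obtain w :: "real ^ 'd" where "w \<in> sphere 0 1" "x = norm x *\<^sub>R w"
  proof (cases "x = 0")
    case True
    then show ?thesis
      using that[of "axis undefined 1"] by (simp add: norm_axis_1)
  next
    case False
    then show ?thesis
      using that[of "x /\<^sub>R norm x"] by simp
  qed
  then show "p x = 0 x"
    using homogeneous_poly_scale_arg[OF p, of "norm x" w] assms(2)[of w] by simp
qed

text \<open>Project \<open>h\<close> orthogonally, in the inner product of the sphere, to the multiples of the squared norm; the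
  remainder \<open>p\<close> is harmonic. The reason is that \<open>p\<close> is orthogonal to all homogeneous polynomials of
  degree \<open>l\<close>, and by the same token to those of degree \<open>l - 2\<close>, as the squared norm is 1 on the sphere. By
  \<open>gauss_integral_laplacian\<close> then \<open>laplacian p\<close> is orthogonal to every homogeneous polynomial of degree \<open>l\<close>, in particular to
  itself.\<close>

lemma homogeneous_poly_decomposition:
  fixes h :: "real ^ 'd::finite \<Rightarrow> real"
  assumes h: "homogeneous_poly (Suc (Suc l)) h"
  shows "\<exists>p g. p \<in> harmonic_polys (Suc (Suc l)) \<and> homogeneous_poly l g \<and>
    h = p + (\<lambda>x. (norm x)\<^sup>2) * g"
proof -
  define N where "N = (\<lambda>x :: real ^ 'd. (norm x)\<^sup>2)"
  have N: "homogeneous_poly 2 N"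
    unfolding N_def by (rule homogeneous_poly_norm_square)
  define E where "E = (monomial ` {m :: 'd \<Rightarrow> nat. (\<Sum>i\<in>UNIV. m i) = l})"
  have span: "span ((*) N ` E) = {N * g |g. homogeneous_poly l g}"
    unfolding span_linear_image[OF linear_times_left] E_def homogeneous_poly_eq_span[symmetric] by auto
  have hom_N: "homogeneous_poly (Suc (Suc l)) (N * g)" if "homogeneous_poly l g" for g
    using homogeneous_poly_times[OF N that] by simp
  have bdd: "q \<in> bounded_sphere" if "homogeneous_poly k q" for k and q :: "real ^ 'd \<Rightarrow> real"
    by (intro poly_bounded_sphere homogeneous_imp_polys[OF that])
  have "(*) N ` E \<subseteq> bounded_sphere"
  proof
    fix v assume "v \<in> (*) N ` E"
    then have "v \<in> span ((*) N ` E)"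
      by (rule span_base)
    then obtain g where "homogeneous_poly l g" "v = N * g"
      unfolding span by blast
    then show "v \<in> bounded_sphere"
      using bdd[OF hom_N] by simp
  qed
  moreover have "finite ((*) N ` E)"
    unfolding E_def by (intro finite_imageI finite_exponents)
  ultimately have "\<exists>u\<in>span ((*) N ` E). \<forall>v\<in>span ((*) N ` E). inner_sphere (h - u) v = 0"
    by (intro sphere.orthogonal_projection_exists bdd[OF h])
  then obtain u where "u \<in> span ((*) N ` E)"
    and u: "\<And>v. v \<in> span ((*) N ` E) \<Longrightarrow> inner_sphere (h - u) v = 0"
    by metis
  then obtain g where g: "homogeneous_poly l g" "u = N * g"
    unfolding span by blast
  define p where "p = h - N * g"
  have p: "homogeneous_poly (Suc (Suc l)) p"
    unfolding p_def using h hom_N[OF g(1)] by (rule homogeneous_poly_diff)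
  have orth: "inner_sphere p v = 0" if v: "homogeneous_poly l v" for v
  proof -
    have "inner_sphere p v = inner_sphere p (N * v)"
      by (rule inner_sphere_cong) (simp_all add: N_def)
    also have "\<dots> = 0"
    proof -
      have "N * v \<in> span ((*) N ` E)"
        unfolding span using v by blast
      then show ?thesis
        using u unfolding p_def g(2) by blast
    qed
    finally show ?thesis .
  qed
  have lap: "homogeneous_poly l (laplacian p)"
    using p by (rule homogeneous_poly_laplacian)
  have low: "gauss_integral (p * laplacian v) = 0" if v: "homogeneous_poly l v" for v
  proof (cases "l < 2")
    case True
    show ?thesis
      unfolding laplacian_low_degree[OF v True] by (simp only: mult_zero_right gauss_integral_zero)
  next
    case False
    then obtain k where k: "l = Suc (Suc k)"
      by (metis One_nat_def Suc_1 less_2_cases_iff not0_implies_Suc)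
    have lv: "homogeneous_poly k (laplacian v)"
      using v unfolding k by (rule homogeneous_poly_laplacian)
    have "inner_sphere p (laplacian v) = inner_sphere p (N * laplacian v)"
      by (rule inner_sphere_cong) (simp_all add: N_def)
    also have "\<dots> = 0"
      using orth homogeneous_poly_times[OF N lv] k by simp
    finally show ?thesis
      using gauss_integral_inner_sphere[OF p lv] by simp
  qed
  have "gauss_integral (laplacian p * laplacian p) = 0"
    using gauss_integral_laplacian[OF p lap] low[OF lap] orth[OF lap] gauss_integral_inner_sphere[OF p lap]
    by simp
  then have "inner_sphere (laplacian p) (laplacian p) = 0"
    using gauss_integral_inner_sphere[OF lap lap] by simp
  from homogeneous_poly_zero_on_sphere[OF lap poly_norm_zero_imp[OF homogeneous_imp_polys[OF lap] this]]
  have "laplacian p = 0" .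
  then have "p \<in> harmonic_polys (Suc (Suc l))"
    using p by (simp add: harmonic_polys_def)
  moreover have "h = p + N * g"
    by (simp add: p_def)
  ultimately show ?thesis
    using g(1) unfolding N_def by blast
qed

lemma subspace_sph_harmonics_upto: "subspace (sph_harmonics_upto q :: (real ^ 'd::finite \<Rightarrow> real) set)"
proof (rule subspaceI)
  show "(0 :: real ^ 'd \<Rightarrow> real) \<in> sph_harmonics_upto q"
    using subspace_0[OF subspace_sph_harmonics]
    by (auto simp: sph_harmonics_upto_def simp del: zero_fun_apply intro!: exI[of _ "\<lambda>_. 0"])
next
  fix u v :: "real ^ 'd \<Rightarrow> real" assume "u \<in> sph_harmonics_upto q" "v \<in> sph_harmonics_upto q"
  then obtain g g' where "\<forall>l\<le>q. g l \<in> sph_harmonics l" "\<forall>l\<le>q. g' l \<in> sph_harmonics l"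
      "u = (\<Sum>l\<le>q. g l)" "v = (\<Sum>l\<le>q. g' l)"
    by (auto simp: sph_harmonics_upto_def)
  then show "u + v \<in> sph_harmonics_upto q"
    unfolding sph_harmonics_upto_def mem_Collect_eq
    by (intro exI[of _ "\<lambda>l. g l + g' l"]) (simp add: sum.distrib subspace_add[OF subspace_sph_harmonics])
next
  fix u :: "real ^ 'd \<Rightarrow> real" and c assume "u \<in> sph_harmonics_upto q"
  then obtain g where "\<forall>l\<le>q. g l \<in> sph_harmonics l" "u = (\<Sum>l\<le>q. g l)"
    by (auto simp: sph_harmonics_upto_def)
  then show "c *\<^sub>R u \<in> sph_harmonics_upto q"
    unfolding sph_harmonics_upto_def mem_Collect_eq
    by (intro exI[of _ "\<lambda>l. c *\<^sub>R g l"]) (simp add: scaleR_sum_right subspace_scale[OF subspace_sph_harmonics])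
qed

lemma sph_harmonics_subset_upto:
  assumes "l \<le> q"
  shows "sph_harmonics l \<subseteq> sph_harmonics_upto q"
proof
  fix u assume u: "u \<in> sph_harmonics l"
  have "(\<Sum>k\<le>q. if k = l then u else 0) = u"
    using assms by simp
  moreover have "\<forall>k\<le>q. (if k = l then u else 0) \<in> sph_harmonics k"
    using u subspace_0[OF subspace_sph_harmonics] by auto
  ultimately show "u \<in> sph_harmonics_upto q"
    unfolding sph_harmonics_upto_def mem_Collect_eq
    by (intro exI[of _ "\<lambda>k. if k = l then u else 0"]) simp
qed

lemma sph_harmonics_upto_minimal:
  assumes "subspace V" "\<And>l. l \<le> q \<Longrightarrow> sph_harmonics l \<subseteq> V"
  shows "sph_harmonics_upto q \<subseteq> V"
  using assms(2) by (auto simp: sph_harmonics_upto_def intro!: subspace_sum[OF assms(1)])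

lemma sph_harmonics_upto_mono: "q \<le> q' \<Longrightarrow> sph_harmonics_upto q \<subseteq> sph_harmonics_upto q'"
  by (intro sph_harmonics_upto_minimal subspace_sph_harmonics_upto sph_harmonics_subset_upto) auto

lemma sph_harmonics_upto_bounded: "sph_harmonics_upto q \<subseteq> bounded_sphere"
  by (intro sph_harmonics_upto_minimal subspace_bounded_sphere sph_harmonics_bounded)

text \<open>On the sphere the factor \<open>(norm x)\<^sup>2\<close> of the decomposition disappears, and the degree drops by 2.\<close>

lemma homogeneous_poly_in_upto:
  "homogeneous_poly l h \<Longrightarrow> restrict_sphere h \<in> sph_harmonics_upto l"
proof (induction l arbitrary: h rule: less_induct)
  case (less l)
  show ?case
  proof (cases "l < 2")
    case True
    then have "restrict_sphere h \<in> sph_harmonics l"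
      using less.prems laplacian_low_degree by (auto simp: sph_harmonics_eq harmonic_polys_def)
    then show ?thesis
      using sph_harmonics_subset_upto by blast
  next
    case False
    then obtain k where k: "l = Suc (Suc k)"
      by (metis One_nat_def Suc_1 less_2_cases_iff not0_implies_Suc)
    obtain p g where p: "p \<in> harmonic_polys l" and g: "homogeneous_poly k g"
      and h: "h = p + (\<lambda>x. (norm x)\<^sup>2) * g"
      using homogeneous_poly_decomposition less.prems unfolding k by blast
    have "restrict_sphere p \<in> sph_harmonics_upto l"
      using p sph_harmonics_subset_upto[of l l] by (auto simp: sph_harmonics_eq)
    moreover have "restrict_sphere g \<in> sph_harmonics_upto l"
      using less.IH[OF _ g] sph_harmonics_upto_mono[of k l] k by auto
    moreover have "restrict_sphere h = restrict_sphere p + restrict_sphere g"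
      by (auto simp: fun_eq_iff restrict_sphere_def h)
    ultimately show ?thesis
      by (simp only: subspace_add[OF subspace_sph_harmonics_upto])
  qed
qed

lemma poly_in_upto:
  assumes "p \<in> polys"
  obtains n where "restrict_sphere p \<in> sph_harmonics_upto n"
proof -
  obtain n g where g: "\<And>l. homogeneous_poly l (g l)" "p = (\<Sum>l\<le>n. g l)"
    using polys_eq_sum_homogeneous[OF assms] by blast
  have "restrict_sphere p = (\<Sum>l\<le>n. restrict_sphere (g l))"
    unfolding g(2) by (rule linear_sum[OF linear_restrict_sphere])
  also have "\<dots> \<in> sph_harmonics_upto n"
    using homogeneous_poly_in_upto[OF g(1)] sph_harmonics_upto_mono
    by (intro subspace_sum[OF subspace_sph_harmonics_upto]) blast
  finally show thesis by (rule that)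
qed

section \<open>Harmonic expansions\<close>

text \<open>The closure, in the norm of the sphere, of the harmonics of all degrees.\<close>

definition harmonic_limit :: "(real ^ 'd::finite \<Rightarrow> real) \<Rightarrow> bool" where
  "harmonic_limit f \<longleftrightarrow> (\<forall>e>0. \<exists>n. \<exists>h\<in>sph_harmonics_upto n. norm_sphere (f - h) < e)"

lemma norm_sphere_le:
  fixes f :: "real ^ 'd::finite \<Rightarrow> real"
  assumes "f \<in> bounded_sphere" "\<And>w. w \<in> sphere 0 1 \<Longrightarrow> \<bar>f w\<bar> \<le> c" "0 \<le> c"
  shows "norm_sphere f \<le> c * sqrt (measure (sphere_measure :: (real ^ 'd) measure) (sphere 0 1))"
proof -
  have "inner_sphere f f \<le> (LINT w|(sphere_measure :: (real ^ 'd) measure). c\<^sup>2)"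
    unfolding inner_sphere_def
  proof (rule integral_mono)
    show "integrable sphere_measure (\<lambda>w. f w * f w)"
      using assms(1) by (intro bounded_sphere_times_integrable)
    show "f w * f w \<le> c\<^sup>2" if "w \<in> space sphere_measure" for w
      using assms(2)[of w] that abs_le_square_iff[of "f w" c] assms(3)
      by (simp add: power2_eq_square)
  qed simp
  also have "\<dots> = c\<^sup>2 * measure (sphere_measure :: (real ^ 'd) measure) (sphere 0 1)"
    by simp
  finally show ?thesis
    unfolding norm_sphere_def using assms(3)
    by (metis abs_of_nonneg real_sqrt_abs real_sqrt_le_iff real_sqrt_mult)
qed

lemma continuous_harmonic_limit:
  fixes f :: "real ^ 'd::finite \<Rightarrow> real"
  assumes f: "continuous_on (sphere 0 1) f"
  shows "harmonic_limit f"
  unfolding harmonic_limit_def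
proof (intro allI impI)
  fix e :: real assume e: "e > 0"
  define a where "a = sqrt (measure (sphere_measure :: (real ^ 'd) measure) (sphere 0 1))"
  have a: "0 \<le> a" by (simp add: a_def)
  define d where "d = e / (a + 1)"
  have d: "d > 0" "d * a < e"
    using a e by (auto simp: d_def field_simps add_nonneg_pos)
  obtain p where p: "real_polynomial_function p" "\<And>x. x \<in> sphere 0 1 \<Longrightarrow> \<bar>f x - p x\<bar> < d"
    using Stone_Weierstrass_real_polynomial_function[OF compact_sphere f d(1)] by blast
  obtain n where n: "restrict_sphere p \<in> sph_harmonics_upto n"
    using poly_in_upto[OF real_polynomial_function_imp_polys[OF p(1)]] .
  have "f - restrict_sphere p \<in> bounded_sphere"
    using sph_harmonics_upto_bounded n continuous_bounded_sphere[OF f]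
    by (blast intro: subspace_diff[OF subspace_bounded_sphere])
  then have "norm_sphere (f - restrict_sphere p) \<le> d * a"
    unfolding a_def using d(1) p(2) by (intro norm_sphere_le) (auto simp: restrict_sphere_def less_imp_le)
  then show "\<exists>n. \<exists>h\<in>sph_harmonics_upto n. norm_sphere (f - h) < e"
    using n d(2) by (intro exI[of _ n] bexI[of _ "restrict_sphere p"]) auto
qed

lemma harmonic_limit_dominated:
  fixes f :: "real ^ 'd::finite \<Rightarrow> real"
  assumes f: "f \<in> bounded_sphere" and g: "\<And>n. g n \<in> bounded_sphere" "\<And>n. harmonic_limit (g n)"
    and C: "\<And>n w. w \<in> sphere 0 1 \<Longrightarrow> \<bar>g n w\<bar> \<le> C"
    and lim: "\<And>w. w \<in> sphere 0 1 \<Longrightarrow> (\<lambda>n. g n w) \<longlonglongrightarrow> f w"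
  shows "harmonic_limit f"
  unfolding harmonic_limit_def
proof (intro allI impI)
  fix e :: real assume e: "e > 0"
  obtain D where D: "\<And>w. w \<in> sphere 0 1 \<Longrightarrow> \<bar>f w\<bar> \<le> D"
    using f unfolding bounded_sphere_def by blast
  have fg: "f - g n \<in> bounded_sphere" for n
    using f g by (blast intro: subspace_diff[OF subspace_bounded_sphere])
  have "(\<lambda>n. inner_sphere (f - g n) (f - g n)) \<longlonglongrightarrow> (LINT w|(sphere_measure :: (real ^ 'd) measure). 0)"
    unfolding inner_sphere_def
  proof (rule integral_dominated_convergence[where w = "\<lambda>_. (D + C)\<^sup>2"])
    show "(\<lambda>w. (f - g n) w * (f - g n) w) \<in> borel_measurable sphere_measure" for n
      using bounded_sphere_times_integrable[OF fg fg] by (rule borel_measurable_integrable)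
    show "AE w in sphere_measure. (\<lambda>n. (f - g n) w * (f - g n) w) \<longlonglongrightarrow> 0"
    proof (rule AE_I2)
      fix w :: "real ^ 'd" assume "w \<in> space sphere_measure"
      then have "w \<in> sphere 0 1"
        by simp
      then have "(\<lambda>n. (f w - g n w) * (f w - g n w)) \<longlonglongrightarrow> (f w - f w) * (f w - f w)"
        by (intro tendsto_intros lim)
      then show "(\<lambda>n. (f - g n) w * (f - g n) w) \<longlonglongrightarrow> 0"
        by simp
    qed
    show "AE w in sphere_measure. norm ((f - g n) w * (f - g n) w) \<le> (D + C)\<^sup>2" for n
    proof (rule AE_I2)
      fix w :: "real ^ 'd" assume "w \<in> space sphere_measure"
      then have "\<bar>f w - g n w\<bar> \<le> D + C"
        using D[of w] C[of w n] by simp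
      then show "norm ((f - g n) w * (f - g n) w) \<le> (D + C)\<^sup>2"
        using power_mono[of "\<bar>f w - g n w\<bar>" "D + C" 2] by (simp add: power2_eq_square abs_mult)
    qed
  qed simp_all
  then have "(\<lambda>n. norm_sphere (f - g n)) \<longlonglongrightarrow> 0"
    unfolding norm_sphere_def using tendsto_real_sqrt by fastforce
  then obtain n where n: "norm_sphere (f - g n) < e / 2"
    using e order_tendstoD(2)[of "\<lambda>n. norm_sphere (f - g n)" 0 sequentially "e / 2"]
    by (auto simp: eventually_sequentially)
  obtain m h where h: "h \<in> sph_harmonics_upto m" "norm_sphere (g n - h) < e / 2"
    using g(2)[of n] e unfolding harmonic_limit_def by (meson half_gt_zero)
  have "g n - h \<in> bounded_sphere"
    using h(1) g(1) sph_harmonics_upto_bounded by (blast intro: subspace_diff[OF subspace_bounded_sphere])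
  from sphere.seminorm_triangle[OF fg[of n] this]
  have "norm_sphere (f - h) < e"
    using n h(2) by simp
  then show "\<exists>n. \<exists>h\<in>sph_harmonics_upto n. norm_sphere (f - h) < e"
    using h(1) by blast
qed

lemma inner_sphere_sum_harmonics:
  assumes "\<And>k. F k \<in> sph_harmonics k" "v \<in> sph_harmonics l" "l \<le> n"
  shows "inner_sphere (\<Sum>k\<le>n. F k) v = inner_sphere (F l) v"
proof -
  have "inner_sphere (\<Sum>k\<le>n. F k) v = (\<Sum>k\<le>n. inner_sphere (F k) v)"
    using assms sph_harmonics_bounded by (intro sphere.ip_sum_left) blast+
  also have "\<dots> = (\<Sum>k\<in>{l}. inner_sphere (F k) v)"
    using assms by (intro sum.mono_neutral_right) (auto intro: sph_harmonics_orthogonal[of _ l])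
  finally show ?thesis by simp
qed

lemma sum_harmonics_in_upto: "(\<And>l. F l \<in> sph_harmonics l) \<Longrightarrow> (\<Sum>l\<le>n. F l) \<in> sph_harmonics_upto n"
  by (auto simp: sph_harmonics_upto_def)

lemma orthogonal_to_upto:
  assumes "x \<in> bounded_sphere" "\<And>l v. l \<le> q \<Longrightarrow> v \<in> sph_harmonics l \<Longrightarrow> inner_sphere x v = 0"
    and "v \<in> sph_harmonics_upto q"
  shows "inner_sphere x v = 0"
proof -
  obtain g where g: "\<forall>l\<le>q. g l \<in> sph_harmonics l" "v = (\<Sum>l\<le>q. g l)"
    using assms(3) by (auto simp: sph_harmonics_upto_def)
  then have "inner_sphere x v = (\<Sum>l\<le>q. inner_sphere x (g l))"
    unfolding g(2) using assms(1) sph_harmonics_bounded by (intro sphere.ip_sum_right) auto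
  also have "\<dots> = 0"
    using assms(2) g(1) by (intro sum.neutral) auto
  finally show ?thesis .
qed

text \<open>The components are the projections to the individual spaces. Their partial sums are the projections to
  \<open>sph_harmonics_upto n\<close>, hence at least as close to \<open>f\<close> as any given approximation from there.\<close>

lemma harmonic_expansion_exists:
  fixes f :: "real ^ 'd::finite \<Rightarrow> real"
  assumes f: "f \<in> bounded_sphere" "harmonic_limit f"
  shows "\<exists>F. harmonic_expansion f F"
proof -
  have "\<exists>u\<in>sph_harmonics l. \<forall>v\<in>sph_harmonics l. inner_sphere (f - u) v = 0" for l
  proof -
    obtain B where B: "finite B" "B \<subseteq> sph_harmonics l"
      "span B = (sph_harmonics l :: (real ^ 'd \<Rightarrow> real) set)"
      using sph_harmonics_basis[where 'd = 'd and l = l] by metis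
    then show ?thesis
      using sphere.orthogonal_projection_exists[OF B(1) _ f(1)] sph_harmonics_bounded by blast
  qed
  then obtain F where F: "\<And>l. F l \<in> sph_harmonics l"
    and orth: "\<And>l v. v \<in> sph_harmonics l \<Longrightarrow> inner_sphere (f - F l) v = 0"
    by metis
  have bdd: "F l \<in> bounded_sphere" "(\<Sum>l\<le>n. F l) \<in> bounded_sphere" for l n
    using F sph_harmonics_bounded sum_harmonics_in_upto[of F, OF F] sph_harmonics_upto_bounded by blast+
  have diff: "f - (\<Sum>l\<le>n. F l) \<in> bounded_sphere" for n
    using f bdd by (blast intro: subspace_diff[OF subspace_bounded_sphere])
  have orth_upto: "inner_sphere (f - (\<Sum>l\<le>n. F l)) v = 0" if v: "v \<in> sph_harmonics_upto n" for n v
  proof (rule orthogonal_to_upto[OF diff _ v])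
    fix l and v :: "real ^ 'd \<Rightarrow> real" assume l: "l \<le> n" and v: "v \<in> sph_harmonics l"
    have "v \<in> bounded_sphere"
      using v sph_harmonics_bounded by blast
    then show "inner_sphere (f - (\<Sum>l\<le>n. F l)) v = 0"
      using orth[OF v] inner_sphere_sum_harmonics[of F, OF F v l] f(1) bdd
      by (simp add: sphere.ip_diff_left)
  qed
  have "(\<lambda>n. norm_sphere (f - (\<Sum>l\<le>n. F l))) \<longlonglongrightarrow> 0"
  proof (rule LIMSEQ_I)
    fix e :: real assume "e > 0"
    then obtain m h where h: "h \<in> sph_harmonics_upto m" "norm_sphere (f - h) < e"
      using f(2) by (auto simp: harmonic_limit_def)
    show "\<exists>m. \<forall>n\<ge>m. norm (norm_sphere (f - (\<Sum>l\<le>n. F l)) - 0) < e"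
    proof (intro exI allI impI)
      fix n assume "m \<le> n"
      then have "h \<in> sph_harmonics_upto n"
        using h(1) sph_harmonics_upto_mono by blast
      then have "(\<Sum>l\<le>n. F l) - h \<in> sph_harmonics_upto n"
        using sum_harmonics_in_upto[of F, OF F] by (intro subspace_diff[OF subspace_sph_harmonics_upto])
      moreover have "h \<in> bounded_sphere"
        using h(1) sph_harmonics_upto_bounded by blast
      ultimately have "norm_sphere (f - (\<Sum>l\<le>n. F l)) \<le> norm_sphere (f - h)"
        by (intro sphere.seminorm_best_approximation(1)[OF f(1) bdd(2)] orth_upto)
      then show "norm (norm_sphere (f - (\<Sum>l\<le>n. F l)) - 0) < e"
        using h(2) sphere.seminorm_nonneg[of "f - (\<Sum>l\<le>n. F l)"] by simp
    qed
  qed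
  then have "harmonic_expansion f F"
    using F sph_harmonics_orthogonal[OF _ F F] by (auto simp: harmonic_expansion_def)
  then show ?thesis by blast
qed

text \<open>The truncation is defined by an arbitrary choice of expansion, but every expansion gives the
  orthogonal projection: the inner product of \<open>v\<close> with the remainder does not depend on the number of terms once
  the degree of \<open>v\<close> is reached, and it tends to 0.\<close>

lemma harmonic_truncation_projection:
  fixes f :: "real ^ 'd::finite \<Rightarrow> real"
  assumes f: "f \<in> bounded_sphere" "harmonic_limit f"
  shows "harmonic_truncation q f \<in> sph_harmonics_upto q"
    and "v \<in> sph_harmonics_upto q \<Longrightarrow> inner_sphere (f - harmonic_truncation q f) v = 0"
proof -
  define F where "F = harmonic_component f"
  have "harmonic_expansion f F"
    unfolding F_def harmonic_component_def using harmonic_expansion_exists[OF f] by (rule someI_ex)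
  then have F: "\<And>l. F l \<in> sph_harmonics l" and lim: "(\<lambda>n. norm_sphere (f - (\<Sum>l\<le>n. F l))) \<longlonglongrightarrow> 0"
    by (auto simp: harmonic_expansion_def)
  have trunc: "harmonic_truncation q f = (\<Sum>l\<le>q. F l)" for q
    by (simp add: harmonic_truncation_def F_def)
  show "harmonic_truncation q f \<in> sph_harmonics_upto q"
    unfolding trunc using F by (rule sum_harmonics_in_upto)
  have bdd: "F l \<in> bounded_sphere" "(\<Sum>l\<le>n. F l) \<in> bounded_sphere" for l n
    using F sph_harmonics_bounded sum_harmonics_in_upto[of F, OF F] sph_harmonics_upto_bounded by blast+
  have diff: "f - (\<Sum>l\<le>n. F l) \<in> bounded_sphere" for n
    using f bdd by (blast intro: subspace_diff[OF subspace_bounded_sphere])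
  show "inner_sphere (f - harmonic_truncation q f) v = 0" if v: "v \<in> sph_harmonics_upto q"
    unfolding trunc
  proof (rule orthogonal_to_upto[OF diff _ v])
    fix l and v :: "real ^ 'd \<Rightarrow> real" assume l: "l \<le> q" and v: "v \<in> sph_harmonics l"
    have vb: "v \<in> bounded_sphere"
      using v sph_harmonics_bounded by blast
    have const: "inner_sphere (f - (\<Sum>k\<le>n. F k)) v = inner_sphere (f - F l) v" if "l \<le> n" for n
      using inner_sphere_sum_harmonics[of F, OF F v that] f(1) bdd vb
      by (simp add: sphere.ip_diff_left)
    have "(\<lambda>n. norm_sphere (f - (\<Sum>l\<le>n. F l)) * norm_sphere v) \<longlonglongrightarrow> 0"
      using tendsto_mult_right[OF lim, of "norm_sphere v"] by simp
    then have "(\<lambda>n. inner_sphere (f - (\<Sum>k\<le>n. F k)) v) \<longlonglongrightarrow> 0"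
      by (rule tendsto_0_le[where K = 1])
         (use sphere.Cauchy_Schwarz[OF diff vb] in \<open>auto intro!: always_eventually simp: abs_mult sphere.seminorm_nonneg\<close>)
    moreover have "(\<lambda>n. inner_sphere (f - (\<Sum>k\<le>n. F k)) v) \<longlonglongrightarrow> inner_sphere (f - F l) v"
      using const by (intro tendsto_eventually eventually_sequentiallyI[of l]) auto
    ultimately show "inner_sphere (f - (\<Sum>k\<le>q. F k)) v = 0"
      using const[OF l] LIMSEQ_unique by metis
  qed
qed

section \<open>Rounded harmonics\<close>

definition round_down :: "real \<Rightarrow> real \<Rightarrow> real" where
  "round_down \<eta> t = \<eta> * of_int \<lfloor>t / \<eta>\<rfloor>"

lemma round_down_error: "\<eta> > 0 \<Longrightarrow> \<bar>round_down \<eta> t - t\<bar> \<le> \<eta>"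
proof -
  assume \<eta>: "\<eta> > 0"
  have "\<bar>of_int \<lfloor>t / \<eta>\<rfloor> - t / \<eta>\<bar> \<le> 1"
    by linarith
  then have "\<eta> * \<bar>of_int \<lfloor>t / \<eta>\<rfloor> - t / \<eta>\<bar> \<le> \<eta> * 1"
    using \<eta> by (intro mult_left_mono) auto
  also have "\<eta> * \<bar>of_int \<lfloor>t / \<eta>\<rfloor> - t / \<eta>\<bar> = \<bar>\<eta> * (of_int \<lfloor>t / \<eta>\<rfloor> - t / \<eta>)\<bar>"
    using \<eta> by (simp add: abs_mult)
  also have "\<dots> = \<bar>round_down \<eta> t - t\<bar>"
    using \<eta> by (simp add: round_down_def right_diff_distrib)
  finally show ?thesis by simp
qed

text \<open>Writes the floor function as a sum of jump functions, each a limit of continuous ones.\<close>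

lemma floor_eq_count:
  assumes "\<bar>t\<bar> \<le> real K"
  shows "real_of_int \<lfloor>t\<rfloor> = (\<Sum>k\<in>{1 - int K..int K}. if of_int k \<le> t then 1 else 0) - real K"
proof -
  have le: "- int K \<le> \<lfloor>t\<rfloor>" "\<lfloor>t\<rfloor> \<le> int K"
    using assms by linarith+
  have "(\<Sum>k\<in>{1 - int K..int K}. if of_int k \<le> t then 1 else (0 :: real)) = (\<Sum>k\<in>{1 - int K..\<lfloor>t\<rfloor>}. 1)"
    using le by (intro sum.mono_neutral_cong_right) (auto simp: le_floor_iff)
  also have "\<dots> = real_of_int \<lfloor>t\<rfloor> + real K"
    using le by simp
  finally show ?thesis by simp
qed

text \<open>Continuous functions that decrease to the jump function at 0. They equal 1 from 0 on, as the jump of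
  the floor function has its upper value at the jump.\<close>

definition ramp :: "nat \<Rightarrow> real \<Rightarrow> real" where
  "ramp n t = min 1 (max 0 (1 + real n * t))"

lemma ramp_tendsto: "(\<lambda>n. ramp n t) \<longlonglongrightarrow> (if 0 \<le> t then 1 else 0)"
proof (cases "0 \<le> t")
  case True
  then show ?thesis by (simp add: ramp_def)
next
  case False
  then obtain m :: nat where m: "1 < real m * (- t)"
    using reals_Archimedean3[of "- t"] by (metis neg_0_less_iff_less not_le)
  have "ramp n t = 0" if "m \<le> n" for n
  proof -
    have "real m * (- t) \<le> real n * (- t)"
      using that False by (intro mult_right_mono) auto
    then show ?thesis
      using m by (simp add: ramp_def)
  qed
  then have "(\<lambda>n. ramp n t) \<longlonglongrightarrow> 0"
    by (intro tendsto_eventually eventually_sequentiallyI[of m]) auto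
  then show ?thesis
    using False by simp
qed

lemma round_down_harmonic_limit:
  fixes g :: "real ^ 'd::finite \<Rightarrow> real"
  assumes g: "continuous_on (sphere 0 1) g" and \<eta>: "\<eta> > 0"
  shows "(\<lambda>w. round_down \<eta> (g w)) \<in> bounded_sphere" "harmonic_limit (\<lambda>w. round_down \<eta> (g w))"
proof -
  obtain C where C: "\<And>w. w \<in> sphere 0 1 \<Longrightarrow> \<bar>g w\<bar> \<le> C"
    using continuous_bounded_sphere[OF g] unfolding bounded_sphere_def by blast
  obtain K :: nat where "C / \<eta> \<le> real K"
    using real_arch_simple by blast
  then have K: "\<bar>g w / \<eta>\<bar> \<le> real K" if "w \<in> sphere 0 1" for w
    using C[OF that] \<eta> by (simp add: abs_divide field_simps)
  define h where "h n w = \<eta> * ((\<Sum>k\<in>{1 - int K..int K}. ramp n (g w / \<eta> - of_int k)) - real K)" for n w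
  have cont: "continuous_on (sphere 0 1) (h n)" for n
    unfolding h_def ramp_def using \<eta> by (intro continuous_intros g) auto
  have lim: "(\<lambda>n. h n w) \<longlonglongrightarrow> round_down \<eta> (g w)" if "w \<in> sphere 0 1" for w
  proof -
    have "(\<lambda>n. h n w) \<longlonglongrightarrow> \<eta> * ((\<Sum>k\<in>{1 - int K..int K}. if 0 \<le> g w / \<eta> - of_int k then 1 else 0) - real K)"
      unfolding h_def by (intro tendsto_intros ramp_tendsto)
    then show ?thesis
      using floor_eq_count[OF K[OF that]] by (simp add: round_down_def)
  qed
  have bound: "\<bar>h n w\<bar> \<le> \<eta> * (2 * real K + real K)" for n w
  proof -
    have "\<bar>\<Sum>k\<in>{1 - int K..int K}. ramp n (g w / \<eta> - of_int k)\<bar> \<le> (\<Sum>k\<in>{1 - int K..int K}. 1)"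
      by (rule order_trans[OF sum_abs sum_mono]) (simp add: ramp_def)
    then have "\<bar>(\<Sum>k\<in>{1 - int K..int K}. ramp n (g w / \<eta> - of_int k)) - real K\<bar> \<le> 2 * real K + real K"
      by simp
    then show ?thesis
      using \<eta> by (simp add: h_def abs_mult)
  qed
  have "(\<lambda>w. round_down \<eta> (g w)) \<in> borel_measurable sphere_measure"
  proof (rule borel_measurable_LIMSEQ_real)
    show "(\<lambda>n. h n w) \<longlonglongrightarrow> round_down \<eta> (g w)" if "w \<in> space sphere_measure" for w
      using that lim by simp
    show "h n \<in> borel_measurable sphere_measure" for n
      using continuous_bounded_sphere[OF cont] by (simp add: bounded_sphere_def)
  qed
  moreover have "\<bar>round_down \<eta> (g w)\<bar> \<le> C + \<eta>" if "w \<in> sphere 0 1" for w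
    using round_down_error[OF \<eta>, of "g w"] C[OF that] by linarith
  ultimately show bdd: "(\<lambda>w. round_down \<eta> (g w)) \<in> bounded_sphere"
    by (rule bounded_sphereI)
  show "harmonic_limit (\<lambda>w. round_down \<eta> (g w))"
    by (rule harmonic_limit_dominated[OF bdd continuous_bounded_sphere[OF cont]
          continuous_harmonic_limit[OF cont] bound lim])
qed

lemma round_down_values:
  assumes "\<eta> > 0" "0 \<le> C"
  shows "\<exists>V. finite V \<and> real (card V) \<le> 2 * C / \<eta> + 5 \<and> (\<forall>t. \<bar>t\<bar> \<le> C \<longrightarrow> round_down \<eta> t \<in> V)"
proof (intro exI conjI allI impI)
  define Z where "Z = \<lceil>C / \<eta>\<rceil> + 1"
  have Z: "0 \<le> Z" "real_of_int Z \<le> C / \<eta> + 2"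
  proof -
    have "0 \<le> C / \<eta>" using assms by simp
    then show "0 \<le> Z" "real_of_int Z \<le> C / \<eta> + 2"
      unfolding Z_def by linarith+
  qed
  show "finite ((\<lambda>z. \<eta> * of_int z) ` {- Z..Z})"
    by simp
  have "card ((\<lambda>z. \<eta> * of_int z) ` {- Z..Z}) \<le> card {- Z..Z}"
    by (rule card_image_le) simp
  then have "real (card ((\<lambda>z. \<eta> * of_int z) ` {- Z..Z})) \<le> real (card {- Z..Z})"
    by linarith
  also have "\<dots> = 2 * real_of_int Z + 1"
    using Z(1) by simp
  also have "\<dots> \<le> 2 * C / \<eta> + 5"
    using Z(2) by simp
  finally show "real (card ((\<lambda>z. \<eta> * of_int z) ` {- Z..Z})) \<le> 2 * C / \<eta> + 5" .
  fix t assume "\<bar>t\<bar> \<le> C"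
  then have "\<bar>t / \<eta>\<bar> \<le> C / \<eta>"
    using assms by (simp add: abs_divide divide_right_mono)
  then have "\<lfloor>t / \<eta>\<rfloor> \<in> {- Z..Z}"
    unfolding Z_def by (simp, linarith)
  then show "round_down \<eta> t \<in> (\<lambda>z. \<eta> * of_int z) ` {- Z..Z}"
    unfolding round_down_def by blast
qed

lemma sph_harmonics_upto_continuous:
  fixes u :: "real ^ 'd::finite \<Rightarrow> real"
  shows "u \<in> sph_harmonics_upto q \<Longrightarrow> continuous_on (sphere 0 1) u"
proof -
  have "subspace {u :: real ^ 'd \<Rightarrow> real. continuous_on (sphere 0 1) u}"
    by (rule subspaceI) (auto simp: zero_fun_def plus_fun_def scaleR_fun_def intro!: continuous_intros)
  moreover have "sph_harmonics l \<subseteq> {u :: real ^ 'd \<Rightarrow> real. continuous_on (sphere 0 1) u}" for l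
  proof
    fix u :: "real ^ 'd \<Rightarrow> real" assume "u \<in> sph_harmonics l"
    then obtain p where p: "u = restrict_sphere p" "p \<in> polys"
      using homogeneous_imp_polys by (auto simp: sph_harmonics_eq harmonic_polys_def)
    have "continuous_on (sphere 0 1) u \<longleftrightarrow> continuous_on (sphere 0 1) p"
      by (rule continuous_on_cong) (simp_all add: p(1) restrict_sphere_def)
    then show "u \<in> {u. continuous_on (sphere 0 1) u}"
      using continuous_on_poly[OF p(2)] by simp
  qed
  ultimately have "sph_harmonics_upto q \<subseteq> {u :: real ^ 'd \<Rightarrow> real. continuous_on (sphere 0 1) u}"
    by (rule sph_harmonics_upto_minimal)
  then show "u \<in> sph_harmonics_upto q \<Longrightarrow> continuous_on (sphere 0 1) u"
    by blast
qed

lemma sph_harmonics_norm_zero: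
  assumes "v \<in> sph_harmonics l" "inner_sphere v v = 0"
  shows "v = 0"
proof -
  obtain p where p: "v = restrict_sphere p" "p \<in> polys"
    using assms(1) homogeneous_imp_polys by (auto simp: sph_harmonics_eq harmonic_polys_def)
  then have "inner_sphere p p = 0"
    using assms(2) by (simp add: inner_sphere_restrict)
  from poly_norm_zero_imp[OF p(2) this] show ?thesis
    by (auto simp: p(1) restrict_sphere_def fun_eq_iff)
qed

text \<open>As spaces of different degrees are orthogonal, orthonormal bases of each of them combine to one
  orthonormal family whose size is the sum of the dimensions.\<close>

lemma orthonormal_harmonics:
  "\<exists>(I :: (nat \<times> (real ^ 'd::finite \<Rightarrow> real)) set) (e :: _ \<Rightarrow> real ^ 'd \<Rightarrow> real).
    finite I \<and> card I = beta TYPE('d) q \<and> (\<forall>i\<in>I. e i \<in> sph_harmonics_upto q) \<and>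
    (\<forall>i\<in>I. \<forall>j\<in>I. inner_sphere (e i) (e j) = (if i = j then 1 else 0))"
proof -
  have "\<exists>B (e :: (real ^ 'd \<Rightarrow> real) \<Rightarrow> real ^ 'd \<Rightarrow> real). finite B \<and> card B = alpha TYPE('d) l \<and> (\<forall>b\<in>B. e b \<in> sph_harmonics l) \<and>
      (\<forall>b\<in>B. \<forall>b'\<in>B. inner_sphere (e b) (e b') = (if b = b' then 1 else 0))"
    for l
  proof -
    obtain B where B: "finite B" "independent B" "B \<subseteq> sph_harmonics l"
      "span B = (sph_harmonics l :: (real ^ 'd \<Rightarrow> real) set)" "card B = alpha TYPE('d) l"
      using sph_harmonics_basis .
    have "B \<subseteq> bounded_sphere"
      using B(3) sph_harmonics_bounded by blast
    moreover have "v = 0" if "v \<in> span B" "inner_sphere v v = 0" for v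
      using that unfolding B(4) by (rule sph_harmonics_norm_zero)
    ultimately have "\<exists>e :: (real ^ 'd \<Rightarrow> real) \<Rightarrow> real ^ 'd \<Rightarrow> real. (\<forall>b\<in>B. e b \<in> span B) \<and>
        (\<forall>b\<in>B. \<forall>b'\<in>B. inner_sphere (e b) (e b') = (if b = b' then 1 else 0))"
      by (rule sphere.orthonormal_family_exists[OF B(1,2)])
    then have "\<exists>e :: (real ^ 'd \<Rightarrow> real) \<Rightarrow> real ^ 'd \<Rightarrow> real. (\<forall>b\<in>B. e b \<in> sph_harmonics l) \<and>
        (\<forall>b\<in>B. \<forall>b'\<in>B. inner_sphere (e b) (e b') = (if b = b' then 1 else 0))"
      unfolding B(4) .
    then show ?thesis
      using B(1,5) by blast
  qed
  then obtain B :: "nat \<Rightarrow> (real ^ 'd \<Rightarrow> real) set"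
    and e :: "nat \<Rightarrow> (real ^ 'd \<Rightarrow> real) \<Rightarrow> real ^ 'd \<Rightarrow> real" where
    B: "\<And>l. finite (B l)" "\<And>l. card (B l) = alpha TYPE('d) l"
    and e: "\<And>l b. b \<in> B l \<Longrightarrow> e l b \<in> sph_harmonics l"
      "\<And>l b b'. b \<in> B l \<Longrightarrow> b' \<in> B l \<Longrightarrow> inner_sphere (e l b) (e l b') = (if b = b' then 1 else 0)"
    by metis
  show ?thesis
  proof (intro exI[of _ "Sigma {..q} B"] exI[of _ "\<lambda>(l, b). e l b"] conjI ballI)
    show "finite (Sigma {..q} B)" "card (Sigma {..q} B) = beta TYPE('d) q"
      using B by (simp_all add: beta_def card_SigmaI)
    show "(case i of (l, b) \<Rightarrow> e l b) \<in> sph_harmonics_upto q" if "i \<in> Sigma {..q} B" for i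
      using that e(1) sph_harmonics_subset_upto by fastforce
    show "inner_sphere (case i of (l, b) \<Rightarrow> e l b) (case j of (l, b) \<Rightarrow> e l b) = (if i = j then 1 else 0)"
      if "i \<in> Sigma {..q} B" "j \<in> Sigma {..q} B" for i j
      using that e(2) sph_harmonics_orthogonal[OF _ e(1) e(1)] by (cases "fst i = fst j") (auto split: prod.splits)
  qed
qed

section \<open>Counting transcripts\<close>

lemma answers_bounded:
  assumes "\<And>h. next_query A \<omega> h \<in> S" "\<And>w. w \<in> S \<Longrightarrow> f w \<in> V"
  shows "set (answers A f \<omega> n) \<subseteq> V \<and> length (answers A f \<omega> n) \<le> n"
  using assms by (induction n) (auto simp: Let_def)

text \<open>For a fixed seed the output depends only on the list of answers. Inputs that the outputs tell apart
  therefore have different lists, of length at most \<open>r\<close> over the possible values.\<close>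

lemma card_distinguished_le:
  assumes V: "finite V" and A: "\<And>h. next_query A \<omega> h \<in> S" "\<And>c w. c \<in> C \<Longrightarrow> w \<in> S \<Longrightarrow> f c w \<in> V"
    and "\<And>c c'. c \<in> C \<Longrightarrow> c' \<in> C \<Longrightarrow> run r A (f c) \<omega> = run r A (f c') \<omega> \<Longrightarrow> c = c'"
  shows "card C \<le> (\<Sum>i\<le>r. card V ^ i)"
proof -
  have "inj_on (\<lambda>c. answers A (f c) \<omega> r) C"
    using assms(4) by (auto simp: inj_on_def run_def)
  moreover have "(\<lambda>c. answers A (f c) \<omega> r) ` C \<subseteq> {xs. set xs \<subseteq> V \<and> length xs \<le> r}"
  proof (intro image_subsetI CollectI)
    fix c assume "c \<in> C"
    then show "set (answers A (f c) \<omega> r) \<subseteq> V \<and> length (answers A (f c) \<omega> r) \<le> r"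
      using A by (intro answers_bounded)
  qed
  ultimately have "card C \<le> card {xs. set xs \<subseteq> V \<and> length xs \<le> r}"
    by (rule card_inj_on_le) (rule finite_lists_length_le[OF V])
  then show ?thesis
    by (simp add: card_lists_length_le[OF V])
qed

text \<open>The expected number of events that occur. The events are measurable because \<open>prob\<close> is 0 on other sets.\<close>

lemma (in prob_space) average_event_count:
  assumes "finite C" "\<delta> > 0" "\<And>c. c \<in> C \<Longrightarrow> prob (E c) \<ge> \<delta>"
    and "\<And>\<omega>. \<omega> \<in> space M \<Longrightarrow> card {c \<in> C. \<omega> \<in> E c} \<le> L"
  shows "\<delta> * real (card C) \<le> real L"
proof -
  have ev: "E c \<in> events" if "c \<in> C" for c
    using assms(2) assms(3)[OF that] measure_notin_sets[of "E c" M] by fastforce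
  have "\<delta> * real (card C) \<le> (\<Sum>c\<in>C. prob (E c))"
    using sum_mono[of C "\<lambda>_. \<delta>" "\<lambda>c. prob (E c)"] assms(3) by (simp add: mult.commute)
  also have "\<dots> = (\<Sum>c\<in>C. expectation (indicator (E c)))"
    using ev by (intro sum.cong) (auto simp: sets.Int_space_eq2)
  also have "\<dots> = expectation (\<lambda>\<omega>. \<Sum>c\<in>C. indicator (E c) \<omega>)"
    using ev by (intro Bochner_Integration.integral_sum[symmetric]) (auto simp: integrable_indicator_iff less_top[symmetric])
  also have "\<dots> \<le> expectation (\<lambda>_. real L)"
  proof (rule integral_mono)
    show "integrable M (\<lambda>\<omega>. \<Sum>c\<in>C. indicator (E c) \<omega> :: real)"
      using ev by (intro Bochner_Integration.integrable_sum) (auto simp: integrable_indicator_iff less_top[symmetric])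
    fix \<omega> assume "\<omega> \<in> space M"
    have "(\<Sum>c\<in>C. indicator (E c) \<omega> :: real) = real (card {c \<in> C. \<omega> \<in> E c})"
      using assms(1) by (simp add: indicator_def sum.If_cases Int_def)
    then show "(\<Sum>c\<in>C. indicator (E c) \<omega> :: real) \<le> real L"
      using assms(4)[OF \<open>\<omega> \<in> space M\<close>] by simp
  qed simp
  also have "\<dots> = real L"
    by (simp add: prob_space)
  finally show ?thesis .
qed

text \<open>As the truncation \<open>t\<close> is the projection of \<open>f\<close>, both \<open>f - t\<close> and \<open>t - g\<close> are at most as long as \<open>f - g\<close>. So
  the admissible error is measured by the distance of the input to the harmonic \<open>g\<close>.\<close>

lemma output_close:
  assumes f: "f \<in> bounded_sphere" "harmonic_limit f" and g: "g \<in> sph_harmonics_upto q"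
    and out: "u \<in> sph_harmonics_upto q"
      "(norm_sphere (u - harmonic_truncation q f))\<^sup>2 \<le> \<epsilon> * (norm_sphere (harmonic_truncation q f - f))\<^sup>2"
    and "\<epsilon> > 0"
  shows "norm_sphere (u - g) \<le> (1 + sqrt \<epsilon>) * norm_sphere (f - g)"
proof -
  define t where "t = harmonic_truncation q f"
  have t: "t \<in> sph_harmonics_upto q"
    unfolding t_def by (rule harmonic_truncation_projection[OF f])
  have bdd: "t \<in> bounded_sphere" "g \<in> bounded_sphere" "u \<in> bounded_sphere"
      "u - t \<in> bounded_sphere" "t - g \<in> bounded_sphere"
    using t g out(1) sph_harmonics_upto_bounded by (blast intro: subspace_diff[OF subspace_bounded_sphere])+
  have "t - g \<in> sph_harmonics_upto q"
    using t g by (rule subspace_diff[OF subspace_sph_harmonics_upto])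
  then have orth: "inner_sphere (f - t) (t - g) = 0"
    unfolding t_def by (rule harmonic_truncation_projection[OF f])
  note best = sphere.seminorm_best_approximation[OF f(1) bdd(1,2) orth]
  have "norm_sphere (u - t) \<le> sqrt \<epsilon> * norm_sphere (t - f)"
    using real_sqrt_le_mono[OF out(2)]
    by (simp add: t_def real_sqrt_mult abs_of_nonneg[OF sphere.seminorm_nonneg])
  also have "\<dots> \<le> sqrt \<epsilon> * norm_sphere (f - g)"
    using best(1) sphere.seminorm_minus_commute[OF f(1) bdd(1)] assms(6)
    by (intro mult_left_mono) auto
  finally have "norm_sphere (u - t) \<le> sqrt \<epsilon> * norm_sphere (f - g)" .
  moreover have "norm_sphere (u - g) \<le> norm_sphere (u - t) + norm_sphere (t - g)"
    using sphere.seminorm_triangle[OF bdd(4,5)] by simp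
  ultimately show ?thesis
    using best(2) by (simp add: algebra_simps)
qed

theorem theorem15:
  fixes q r :: nat and \<epsilon> :: real
    and M :: "'w measure" and A :: "('w, 'd::finite) query_algorithm"
  assumes "CARD('d) \<ge> 2"
    and "\<epsilon> > 0"
    and "randomized_query_algorithm M A"
    and "\<forall>f\<in>L2_sphere. \<forall>\<omega>\<in>space M. at_most_queries r A f \<omega>"
    and "\<forall>f\<in>L2_sphere.
           \<P>(\<omega> in M. run r A f \<omega> \<in> sph_harmonics_upto q \<and>
             (norm_sphere (run r A f \<omega> - harmonic_truncation q f))\<^sup>2
               \<le> \<epsilon> * (norm_sphere (harmonic_truncation q f - f))\<^sup>2) > 1 / 10"
  shows "r \<ge> beta TYPE('d) q"
proof (rule ccontr)
  assume "\<not> r \<ge> beta TYPE('d) q"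
  then have r: "Suc r \<le> beta TYPE('d) q"
    by simp
  interpret prob_space M
    using assms(3) by (simp add: randomized_query_algorithm_def)
  obtain I :: "(nat \<times> (real ^ 'd \<Rightarrow> real)) set"
    and e :: "nat \<times> (real ^ 'd \<Rightarrow> real) \<Rightarrow> real ^ 'd \<Rightarrow> real" where I: "finite I" "card I = beta TYPE('d) q"
    and e: "\<And>i. i \<in> I \<Longrightarrow> e i \<in> sph_harmonics_upto q"
    and orth: "\<And>i j. i \<in> I \<Longrightarrow> j \<in> I \<Longrightarrow> inner_sphere (e i) (e j) = (if i = j then 1 else 0)"
    using orthonormal_harmonics[where 'd = 'd and q = q] by blast
  have e_bdd: "e i \<in> bounded_sphere" if "i \<in> I" for i
    using e[OF that] sph_harmonics_upto_bounded by blast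
  then have "\<forall>i\<in>I. \<exists>C. \<forall>w\<in>sphere 0 1. \<bar>e i w\<bar> \<le> C"
    by (auto simp: bounded_sphere_def)
  then obtain b where b: "\<And>i w. i \<in> I \<Longrightarrow> w \<in> sphere 0 1 \<Longrightarrow> \<bar>e i w\<bar> \<le> b i"
    by metis
  \<comment> \<open>\<open>B\<close> bounds the basis uniformly, \<open>a\<close> is the norm of the constant 1. The step \<open>\<eta>\<close> is such that outputs are
    within distance \<open>1/2\<close> of the intended harmonic, and \<open>\<kappa> * N\<close> bounds the number of values of the inputs. The
    choice of \<open>N\<close> makes \<open>(r + 1) * (\<kappa> * N)^r\<close> transcripts too few for a tenth of \<open>N^(r + 1)\<close> inputs.\<close>
  define B where "B = (\<Sum>i\<in>I. \<bar>b i\<bar>)"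
  define a where "a = sqrt (measure (sphere_measure :: (real ^ 'd) measure) (sphere 0 1))"
  define D where "D = (1 + sqrt \<epsilon>) * a"
  define \<eta> where "\<eta> = 1 / (2 * (D + 1))"
  have D: "0 \<le> D"
    using assms(2) by (simp add: D_def a_def)
  then have \<eta>: "\<eta> > 0" "D * \<eta> < 1 / 2"
    by (simp_all add: \<eta>_def field_simps)
  define \<kappa> where "\<kappa> = 2 * B / \<eta> + 5"
  have B: "0 \<le> B"
    by (simp add: B_def sum_nonneg)
  have \<kappa>: "1 \<le> \<kappa>"
    using B \<eta>(1) by (simp add: \<kappa>_def add_increasing)
  obtain N :: nat where N: "10 * (real r + 1) * \<kappa> ^ r < real N"
    using reals_Archimedean2 by blast
  have N1: "1 \<le> real N"
  proof -
    have "0 \<le> 10 * (real r + 1) * \<kappa> ^ r"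
      using \<kappa> by simp
    then have "0 < real N"
      using N by linarith
    then show ?thesis by simp
  qed
  define C where "C = (I \<rightarrow>\<^sub>E {..<N})"
  define g where "g c = (\<Sum>i\<in>I. real (c i) *\<^sub>R e i)" for c :: "_ \<Rightarrow> nat"
  define f where "f c w = round_down \<eta> (g c w)" for c w
  have g_upto: "g c \<in> sph_harmonics_upto q" for c
    unfolding g_def using e
    by (intro subspace_sum[OF subspace_sph_harmonics_upto] subspace_scale[OF subspace_sph_harmonics_upto])
  have g_bdd: "g c \<in> bounded_sphere" for c
    using g_upto sph_harmonics_upto_bounded by blast
  have g_bound: "\<bar>g c w\<bar> \<le> real N * B" if "c \<in> C" "w \<in> sphere 0 1" for c w
  proof -
    have "\<bar>g c w\<bar> \<le> (\<Sum>i\<in>I. \<bar>real (c i) * e i w\<bar>)"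
      by (simp add: g_def sum_fun_apply sum_abs)
    also have "\<dots> \<le> (\<Sum>i\<in>I. real N * \<bar>b i\<bar>)"
    proof (rule sum_mono)
      fix i assume i: "i \<in> I"
      then have "c i < N"
        using that(1) by (auto simp: C_def)
      then show "\<bar>real (c i) * e i w\<bar> \<le> real N * \<bar>b i\<bar>"
        using b[OF i that(2)] by (auto simp: abs_mult intro!: mult_mono)
    qed
    finally show ?thesis
      by (simp add: B_def sum_distrib_left)
  qed
  have f_lim: "f c \<in> bounded_sphere" "harmonic_limit (f c)" for c
    unfolding f_def
    by (intro round_down_harmonic_limit sph_harmonics_upto_continuous[OF g_upto] \<eta>(1))+
  have fg: "norm_sphere (f c - g c) \<le> \<eta> * a" for c
    unfolding a_def
  proof (rule norm_sphere_le)
    show "f c - g c \<in> bounded_sphere"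
      using f_lim(1) g_bdd by (rule subspace_diff[OF subspace_bounded_sphere])
    show "\<bar>(f c - g c) w\<bar> \<le> \<eta>" for w
      using round_down_error[OF \<eta>(1)] by (simp add: f_def)
    show "0 \<le> \<eta>"
      using \<eta>(1) by simp
  qed
  have separated: "1 \<le> norm_sphere (g c - g c')" if "c \<in> C" "c' \<in> C" "c \<noteq> c'" for c c'
  proof -
    have "\<exists>i\<in>I. c i \<noteq> c' i"
      using PiE_ext[of c I "\<lambda>_. {..<N}" c'] that unfolding C_def by blast
    then obtain i where i: "i \<in> I" "c i \<noteq> c' i"
      by blast
    have coeff: "inner_sphere (g c) (e i) = real (c i)" for c
    proof -
      have "inner_sphere (g c) (e i) = (\<Sum>j\<in>I. inner_sphere (real (c j) *\<^sub>R e j) (e i))"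
        unfolding g_def using e_bdd i(1)
        by (intro sphere.ip_sum_left) (auto intro: subspace_scale[OF subspace_bounded_sphere])
      also have "\<dots> = (\<Sum>j\<in>I. if j = i then real (c j) else 0)"
        using orth i(1) e_bdd by (intro sum.cong) (auto simp: sphere.ip_scale_left)
      finally show ?thesis
        using I(1) i(1) by simp
    qed
    have "1 \<le> \<bar>real (c i) - real (c' i)\<bar>"
      using i(2) by linarith
    also have "\<dots> = \<bar>inner_sphere (g c - g c') (e i)\<bar>"
      using g_bdd e_bdd[OF i(1)] by (simp add: sphere.ip_diff_left coeff)
    also have "\<dots> \<le> norm_sphere (g c - g c') * norm_sphere (e i)"
      using g_bdd e_bdd[OF i(1)]
      by (intro sphere.Cauchy_Schwarz subspace_diff[OF subspace_bounded_sphere])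
    also have "norm_sphere (e i) = 1"
      using orth[OF i(1) i(1)] by (simp add: norm_sphere_def)
    finally show ?thesis by (simp only: mult_1_right)
  qed
  define E where "E c = {\<omega> \<in> space M. run r A (f c) \<omega> \<in> sph_harmonics_upto q \<and>
             (norm_sphere (run r A (f c) \<omega> - harmonic_truncation q (f c)))\<^sup>2
               \<le> \<epsilon> * (norm_sphere (harmonic_truncation q (f c) - f c))\<^sup>2}" for c
  have near: "run r A (f c) \<omega> \<in> bounded_sphere \<and> norm_sphere (run r A (f c) \<omega> - g c) < 1 / 2" if "\<omega> \<in> E c" for c \<omega>
  proof -
    have run: "run r A (f c) \<omega> \<in> sph_harmonics_upto q"
      using that by (simp add: E_def)
    have "norm_sphere (run r A (f c) \<omega> - g c) \<le> (1 + sqrt \<epsilon>) * norm_sphere (f c - g c)"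
      using that by (intro output_close[OF f_lim g_upto run _ assms(2)]) (simp add: E_def)
    also have "\<dots> \<le> (1 + sqrt \<epsilon>) * (\<eta> * a)"
      using fg assms(2) by (intro mult_left_mono) auto
    also have "\<dots> < 1 / 2"
      using \<eta>(2) by (simp add: D_def mult_ac)
    finally show ?thesis
      using run sph_harmonics_upto_bounded by blast
  qed
  obtain V where V: "finite V" "real (card V) \<le> 2 * (real N * B) / \<eta> + 5"
    "\<And>t. \<bar>t\<bar> \<le> real N * B \<Longrightarrow> round_down \<eta> t \<in> V"
    using round_down_values[OF \<eta>(1), of "real N * B"] B by auto
  have "card {c \<in> C. \<omega> \<in> E c} \<le> (\<Sum>i\<le>r. card V ^ i)" if "\<omega> \<in> space M" for \<omega>
  proof (rule card_distinguished_le[OF V(1), of A \<omega> "sphere 0 1" _ f])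
    show "next_query A \<omega> h \<in> sphere 0 1" for h
      using assms(3) that by (simp add: randomized_query_algorithm_def)
    show "f c w \<in> V" if "c \<in> {c \<in> C. \<omega> \<in> E c}" "w \<in> sphere 0 1" for c w
      unfolding f_def using that by (intro V(3) g_bound) auto
    show "c = c'" if "c \<in> {c \<in> C. \<omega> \<in> E c}" "c' \<in> {c \<in> C. \<omega> \<in> E c}"
      and eq: "run r A (f c) \<omega> = run r A (f c') \<omega>" for c c'
    proof (rule ccontr)
      assume "c \<noteq> c'"
      define u where "u = run r A (f c) \<omega>"
      have u: "u \<in> bounded_sphere" "norm_sphere (u - g c) < 1 / 2" "norm_sphere (u - g c') < 1 / 2"
        using near[of \<omega> c] near[of \<omega> c'] that by (auto simp: u_def)
      have "norm_sphere (g c - g c') = norm_sphere ((g c - u) + (u - g c'))"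
        by simp
      also have "\<dots> \<le> norm_sphere (g c - u) + norm_sphere (u - g c')"
        using u(1) g_bdd by (intro sphere.seminorm_triangle subspace_diff[OF subspace_bounded_sphere])
      also have "norm_sphere (g c - u) = norm_sphere (u - g c)"
        using u(1) g_bdd by (intro sphere.seminorm_minus_commute)
      finally have "norm_sphere (g c - g c') \<le> norm_sphere (u - g c) + norm_sphere (u - g c')" .
      moreover have "1 \<le> norm_sphere (g c - g c')"
        using that \<open>c \<noteq> c'\<close> by (intro separated) auto
      ultimately show False
        using u(2,3) by linarith
    qed
  qed
  moreover have "1 / 10 \<le> prob (E c)" for c
    using assms(5) f_lim(1)[of c] bounded_sphere_subset_L2 unfolding E_def by fastforce
  moreover have "finite C"
    unfolding C_def using I(1) by (intro finite_PiE) auto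
  ultimately have "1 / 10 * real (card C) \<le> real (\<Sum>i\<le>r. card V ^ i)"
    by (intro average_event_count[where E = E]) auto
  also have "\<dots> \<le> (\<Sum>i\<le>r. (\<kappa> * real N) ^ r)"
  proof -
    have card_V: "real (card V) \<le> \<kappa> * real N"
    proof -
      have "5 \<le> 5 * real N" using N1 by simp
      then show ?thesis
        using V(2) by (simp add: \<kappa>_def algebra_simps)
    qed
    have \<kappa>N: "1 \<le> \<kappa> * real N"
      using mult_mono[OF \<kappa> N1] \<kappa> by simp
    have "real (card V) ^ i \<le> (\<kappa> * real N) ^ r" if "i \<le> r" for i
      using power_mono[OF card_V, of i] power_increasing[OF that \<kappa>N] by simp
    then show ?thesis
      unfolding of_nat_sum of_nat_power by (intro sum_mono) simp
  qed
  also have "\<dots> = (real r + 1) * \<kappa> ^ r * real N ^ r"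
    by (simp add: power_mult_distrib)
  also have "\<dots> < real N / 10 * real N ^ r"
  proof (rule mult_strict_right_mono)
    show "(real r + 1) * \<kappa> ^ r < real N / 10"
      using N by (simp add: field_simps)
  qed (use N1 in simp)
  also have "\<dots> = 1 / 10 * real N ^ Suc r"
    by simp
  also have "\<dots> \<le> 1 / 10 * real N ^ card I"
    using r N1 I(2) by (intro mult_left_mono power_increasing) auto
  also have "real N ^ card I = real (card C)"
    unfolding C_def using I(1) by (simp add: card_PiE)
  finally show False by simp
qed

end
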